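(* Fix integers $r,t,s\ge 0$ and integers $1\le \alpha_1<\cdots<\alpha_r$, $1\le \beta_1<\cdots<\beta_t$, $0\le\gamma_1<\cdots<\gamma_s$. For positive integers $n$ with $\alpha_r<\frac n2$, $\beta_t<\frac n2$, $\gamma_s\le n-1$ let $\Gamma_1$ and, if $n$ is even, $\Gamma_2,\Gamma_3,\Gamma_4$ be the associated bicirculant graphs on $2n$ vertices defined in the context, and let $f_{\Gamma_i}(2n)$ be the number of rooted spanning forests of $\Gamma_i$; for each $i$ only those $n$ for which $\Gamma_i$ is connected are considered. Let $k_1$ be the number of odd numbers in $\{\alpha_1,\dots,\alpha_r\}$, $m_1$ the number of odd numbers in $\{\beta_1,\dots,\beta_t\}$, and $h_1$ (resp. $h_2$) the number of odd (resp. even) numbers in $\{\gamma_1,\dots,\gamma_s\}$. Let $\ell_1,q_1,q_2,q_3,q_4$ be the square-free parts of, respectively, $$(2s+1)\big((4k_1+s+1)(4m_1+s+1)-(h_2-h_1)^2\big),\qquad 2s+1,$$ $$(2s+1)\big((4k_1+s+3)(4m_1+s+1)-(h_2-h_1)^2\big),\qquad (2s+1)\big((4k_1+s+1)(4m_1+s+3)-(h_2-h_1)^2\big),$$ $$(2s+1)\big((4k_1+s+3)(4m_1+s+3)-(h_2-h_1)^2\big).$$ Then: (1) there exist integer sequences $a_1(n)$, $b_1(n)$ such that $f_{\Gamma_1}(2n)=q_1a_1(n)^2$ if $n$ is odd, and $f_{\Gamma_1}(2n)=\ell_1b_1(n)^2$ if $n$ is even; (2) for $n$ even, there exist integer sequences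 $a_2(n)$, $b_2(n)$ such that $f_{\Gamma_2}(2n)=q_2a_2(n)^2$ if $\frac n2$ is odd, and $f_{\Gamma_2}(2n)=\ell_1b_2(n)^2$ if $\frac n2$ is even; (3) for $n$ even, there exist integer sequences $a_3(n)$, $b_3(n)$ such that $f_{\Gamma_3}(2n)=q_3a_3(n)^2$ if $\frac n2$ is odd, and $f_{\Gamma_3}(2n)=\ell_1b_3(n)^2$ if $\frac n2$ is even; (4) for $n$ even, there exist integer sequences $a_4(n)$, $b_4(n)$ such that $f_{\Gamma_4}(2n)=q_4a_4(n)^2$ if $\frac n2$ is odd, and $f_{\Gamma_4}(2n)=\ell_1b_4(n)^2$ if $\frac n2$ is even.
   Context: Bicirculant graph: for $R=-R\subseteq\mathbb Z_n\setminus\{0\}$, $T=-T\subseteq\mathbb Z_n\setminus\{0\}$, $S\subseteq\mathbb Z_n$, the simple undirected graph $BC(\mathbb Z_n;R,T,S)$ has vertex set $\{g_0: g\in\mathbb Z_n\}\sqcup\{g_1: g\in\mathbb Z_n\}$ ($2n$ vertices) and edges $\{h_0,g_0\}$ when $g-h\in R$, $\{h_1,g_1\}$ when $g-h\in T$, and $\{h_0,g_1\}$ when $g-h\in S$. The four graphs (integers reduced mod $n$): put $R=\{\pm\alpha_1,\dots,\pm\alpha_r\}$, $T=\{\pm\beta_1,\dots,\pm\beta_t\}$, $S=\{\gamma_1,\dots,\gamma_s\}$. Then $\Gamma_1=BC(\mathbb Z_n;R,T,S)$ and, for $n$ even, $\Gamma_2=BC(\mathbb Z_n;R\cup\{\frac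 n2\},T,S)$, $\Gamma_3=BC(\mathbb Z_n;R,T\cup\{\frac n2\},S)$, $\Gamma_4=BC(\mathbb Z_n;R\cup\{\frac n2\},T\cup\{\frac n2\},S)$. Rooted spanning forest of a graph $\Gamma$: an acyclic subgraph containing all vertices of $\Gamma$, together with a choice of one vertex (root) in each of its connected components. Square-free part: every positive integer $u$ is uniquely $u=vr^2$ with $v,r$ positive integers and $v$ square-free; $v$ is the square-free part of $u$. If $r=0$ (resp. $t=0$, $s=0$), the conditions involving $\alpha_r$ (resp. $\beta_t$, $\gamma_s$) are vacuous. *)

theory Defs
  imports "HOL-Computational_Algebra.Computational_Algebra"
begin

text \<open>
  Finite simple undirected graphs as vertex set plus set of two-element edges.  The symmetric
  digraphs of the AFP entry Graph_Theory are not used, because there an edge traversed back and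
  forth already counts as a cycle, so that its notion of forest is not the undirected one.
\<close>

record 'a ugraph =
  uverts :: "'a set"
  uedges :: "'a set set"

definition simple_ugraph :: "'a ugraph \<Rightarrow> bool" where
  "simple_ugraph G \<longleftrightarrow> finite (uverts G) \<and> (\<forall>e\<in>uedges G. e \<subseteq> uverts G \<and> card e = 2)"

definition sub_ugraph :: "'a ugraph \<Rightarrow> 'a ugraph \<Rightarrow> bool" where
  "sub_ugraph H G \<longleftrightarrow>
     uverts H \<subseteq> uverts G \<and> uedges H \<subseteq> uedges G \<and> (\<forall>e\<in>uedges H. e \<subseteq> uverts H)"

definition reach_rel :: "'a ugraph \<Rightarrow> ('a \<times> 'a) set" where
  "reach_rel G = {(u, v). {u, v} \<in> uedges G}\<^sup>* \<inter> uverts G \<times> uverts G"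

definition components_of_ugraph :: "'a ugraph \<Rightarrow> 'a set set" where
  "components_of_ugraph G = uverts G // reach_rel G"

definition connected_ugraph :: "'a ugraph \<Rightarrow> bool" where
  "connected_ugraph G \<longleftrightarrow>
     uverts G \<noteq> {} \<and> (\<forall>u\<in>uverts G. \<forall>v\<in>uverts G. (u, v) \<in> reach_rel G)"

definition cycle_of_ugraph :: "'a ugraph \<Rightarrow> 'a list \<Rightarrow> bool" where
  "cycle_of_ugraph G p \<longleftrightarrow>
     3 \<le> length p \<and> distinct p \<and>
     (\<forall>i<length p. {p ! i, p ! (Suc i mod length p)} \<in> uedges G)"

definition acyclic_ugraph :: "'a ugraph \<Rightarrow> bool" where
  "acyclic_ugraph G \<longleftrightarrow> (\<nexists>p. cycle_of_ugraph G p)"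

text \<open>
  A choice of one root in each component of \<open>F\<close> is encoded as the set \<open>W\<close> of chosen roots.
\<close>

definition rooted_spanning_forests :: "'a ugraph \<Rightarrow> ('a ugraph \<times> 'a set) set" where
  "rooted_spanning_forests G =
     {(F, W). sub_ugraph F G \<and> uverts F = uverts G \<and> acyclic_ugraph F \<and>
        W \<subseteq> uverts F \<and> (\<forall>C\<in>components_of_ugraph F. \<exists>!v. v \<in> W \<inter> C)}"

definition num_rooted_spanning_forests :: "'a ugraph \<Rightarrow> nat" where
  "num_rooted_spanning_forests G = card (rooted_spanning_forests G)"

text \<open>
  The integers modulo \<open>n\<close> are represented by their residues in \<open>{0..<int n}\<close>, and \<open>R\<close>, \<open>T\<close>, \<open>S\<close>
  are sets of such residues.  The vertices \<open>g\<^sub>0\<close> and \<open>g\<^sub>1\<close> are \<open>Inl g\<close> and \<open>Inr g\<close>.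
\<close>

definition bicirculant :: "nat \<Rightarrow> int set \<Rightarrow> int set \<Rightarrow> int set \<Rightarrow> (int + int) ugraph" where
  "bicirculant n R T S =
     \<lparr> uverts = {0..<int n} <+> {0..<int n},
       uedges =
         {{Inl h, Inl g} | h g. h \<in> {0..<int n} \<and> g \<in> {0..<int n} \<and> (g - h) mod int n \<in> R} \<union>
         {{Inr h, Inr g} | h g. h \<in> {0..<int n} \<and> g \<in> {0..<int n} \<and> (g - h) mod int n \<in> T} \<union>
         {{Inl h, Inr g} | h g. h \<in> {0..<int n} \<and> g \<in> {0..<int n} \<and> (g - h) mod int n \<in> S} \<rparr>"

lemma simple_bicirculant:
  assumes "0 \<notin> R" "0 \<notin> T"
  shows "simple_ugraph (bicirculant n R T S)"
  using assms by (auto simp: simple_ugraph_def bicirculant_def card_insert_if)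

definition residues_mod :: "nat \<Rightarrow> int set \<Rightarrow> int set" where
  "residues_mod n A = (\<lambda>a. a mod int n) ` A"

definition pm_residues_mod :: "nat \<Rightarrow> int set \<Rightarrow> int set" where
  "pm_residues_mod n A = residues_mod n (A \<union> uminus ` A)"

end

theory Submission
  imports
    Defs
    "HOL-Library.FuncSet"
    "HOL-Library.Transitive_Closure_Table"
    "Jordan_Normal_Form.Determinant"
begin

text \<open>
  The number of rooted spanning forests of a graph is \<open>det (I + L)\<close> with \<open>L\<close> the Laplacian.  For a
  bicirculant graph \<open>I + L\<close> consists of four commuting circulant blocks, so that this determinant is
  the determinant of a single symmetric circulant matrix \<open>M\<close>.  As \<open>M\<close> commutes with the reflection
  \<open>k \<mapsto> - k\<close> and with the shift \<open>\<sigma>\<close>, it maps odd functions on the residues modulo \<open>n\<close> to odd ones,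
  by an integer matrix \<open>B\<close> say, and the operator \<open>\<sigma> - \<sigma>\<inverse>\<close> carries the odd functions to even ones
  on which \<open>M\<close> acts by the same \<open>B\<close>.  Only the constants and, for even \<open>n\<close>, the alternating function
  are left over, whence \<open>det M = \<lambda>\<^sub>1 \<lambda>\<^sub>2 (det B)\<^sup>2\<close> with the eigenvalues \<open>\<lambda>\<^sub>1\<close> and \<open>\<lambda>\<^sub>2\<close> of these
  functions (and without \<open>\<lambda>\<^sub>2\<close> for odd \<open>n\<close>).
\<close>

section \<open>The matrix forest theorem\<close>

text \<open>The obstacle is integrality. Pairing the equal eigenvalues at inverse characters also
  exhibits a square, but the square of a product of algebraic numbers, which would still have to be
  shown to be an integer. The matrix on odd functions settles this at once: those functions have an
  evident integral basis. The even ones get no basis of their own. The operator \<sigma> -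
  \<sigma>^-1 is injective on odd functions, because an odd function of period 2 vanishes, so their
  images can be used instead. The base change need not be unimodular, but it intertwines two integer
  matrices and its nonzero determinant cancels. The constants are values of (1 + |R| + s - sum over
  R)(1 + |T| + s - sum over T) - (sum over S)^2, the sums being those of a real character. The
  trivial character gives (1 + s)^2 - s^2 = 2s + 1. For the alternating one an odd generator
  contributes 4 (two residues, each counted once in the degree and once through its sign), the
  residue n/2 contributes 2 or 0 according to its parity, and the sum over S is the number of even
  minus the number of odd elements.\<close>

definition edge_form :: "'a set \<Rightarrow> 'a \<Rightarrow> 'a \<Rightarrow> int" where
  "edge_form e i j =
     (if card e = 2 \<and> i \<in> e \<and> j \<in> e then if i = j then 1 else -1 else 0)"

text \<open>The Laplacian of one edge is the rank-one matrix of \<open>e_p - e_q\<close>. For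
  \<open>p = q\<close> both sides vanish: the guard \<open>card e = 2\<close> in
  \<open>edge_form\<close> is there because contraction may send an edge to a singleton, a loop,
  which has to contribute nothing.\<close>

lemma edge_form_pair:
  "edge_form {p, q} i j = (of_bool (i = p) - of_bool (i = q)) * (of_bool (j = p) - of_bool (j = q))"
  by (auto simp: edge_form_def card_insert_if)

text \<open>
  Contracted vertices keep a unit row and column, so that contraction does not change the dimension.
\<close>

definition merge_matrix :: "'a \<Rightarrow> 'a \<Rightarrow> ('a \<Rightarrow> 'a \<Rightarrow> int) \<Rightarrow> 'a \<Rightarrow> 'a \<Rightarrow> int" where
  "merge_matrix a b M i j =
     (if i = a \<or> j = a then of_bool (i = j)
      else M i j + of_bool (i = b) * M a j + of_bool (j = b) * M i a
             + of_bool (i = b) * of_bool (j = b) * M a a)"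

text \<open>The determinant is affine in its entry at (a, a), with the cofactor there as slope. That
  cofactor is written as a determinant of the same size by giving row and column \<open>a\<close>
  the shape of the identity.\<close>

lemma det_add_unit_entry:
  fixes A :: "'a :: comm_ring_1 mat"
  assumes A: "A \<in> carrier_mat N N" and a: "a < N"
  shows "det (mat N N (\<lambda>(i, j). A $$ (i, j) + of_bool (i = a) * of_bool (j = a))) =
    det A + det (mat N N (\<lambda>(i, j). if i = a \<or> j = a then of_bool (i = j) else A $$ (i, j)))"
    (is "det ?B = det A + det ?C")
proof -
  have del: "mat_delete ?B a j = mat_delete A a j" "mat_delete ?C a a = mat_delete A a a" if "j < N" for j
    using A a that by (auto simp: mat_delete_def intro!: eq_matI)
  have "det ?B = (\<Sum>j<N. ?B $$ (a, j) * cofactor ?B a j)"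
    by (rule laplace_expansion_row) (use a in auto)
  also have "\<dots> = (\<Sum>j<N. A $$ (a, j) * cofactor A a j + (if j = a then cofactor A a a else 0))"
    by (rule sum.cong) (use a del(1) in \<open>auto simp: cofactor_def algebra_simps\<close>)
  also have "\<dots> = det A + cofactor A a a"
    using a by (simp add: sum.distrib laplace_expansion_row[OF A a])
  also have "cofactor A a a = (\<Sum>j<N. if j = a then cofactor ?C a a else 0)"
    using a del(2)[OF a] by (simp add: cofactor_def)
  also have "\<dots> = (\<Sum>j<N. ?C $$ (a, j) * cofactor ?C a j)"
    by (rule sum.cong) (use a in auto)
  also have "\<dots> = det ?C"
    by (rule laplace_expansion_row[symmetric]) (use a in auto)
  finally show ?thesis .
qed

text \<open>An enumeration \<open>f\<close> turns matrices indexed by vertices into matrices indexed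
  by numbers. It stays a parameter because a particular order will produce the block form of a
  bicirculant graph.\<close>

locale finite_enum =
  fixes V :: "'a set" and N :: nat and f :: "nat \<Rightarrow> 'a"
  assumes bij: "bij_betw f {..<N} V"
begin

lemma finite_V [simp]: "finite V"
  using bij bij_betw_finite by blast

definition det_on :: "('a \<Rightarrow> 'a \<Rightarrow> int) \<Rightarrow> int" where
  "det_on M = det (mat N N (\<lambda>(i, j). M (f i) (f j)))"

lemma f_in: "i < N \<Longrightarrow> f i \<in> V"
  using bij by (auto simp: bij_betw_def)

lemma f_eq_iff: "i < N \<Longrightarrow> j < N \<Longrightarrow> f i = f j \<longleftrightarrow> i = j"
  using bij by (auto simp: bij_betw_def inj_on_def)

lemma det_on_cong: "(\<And>i j. i \<in> V \<Longrightarrow> j \<in> V \<Longrightarrow> M i j = M' i j) \<Longrightarrow> det_on M = det_on M'"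
  unfolding det_on_def by (intro arg_cong[where f = det] cong_mat) (auto intro: f_in)

lemma det_on_diag:
  "det_on (\<lambda>i j. if i = j then d i else 0) = (\<Prod>i\<in>V. d i)"
proof -
  let ?A = "mat N N (\<lambda>(i, j). if f i = f j then d (f i) else 0)"
  have "det ?A = prod_list (diag_mat ?A)"
    by (rule det_upper_triangular[where n = N]) (auto simp: f_eq_iff)
  also have "\<dots> = (\<Prod>i\<in>{..<N}. d (f i))"
    by (simp add: prod_list_diag_prod atLeast0LessThan)
  also have "\<dots> = (\<Prod>i\<in>V. d i)"
    by (rule prod.reindex_bij_betw[OF bij])
  finally show ?thesis by (simp add: det_on_def)
qed

text \<open>Congruence by an elementary matrix: row \<open>a\<close> is added to row
  \<open>b\<close>, then column \<open>a\<close> to column \<open>b\<close>. The term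
  \<open>M a a\<close> appears because the column operation meets the already changed row
  \<open>b\<close>.\<close>

lemma det_on_add_row_col:
  assumes "a \<in> V" "b \<in> V" "a \<noteq> b"
  shows "det_on (\<lambda>i j. M i j + of_bool (i = b) * M a j + of_bool (j = b) * M i a
             + of_bool (i = b) * of_bool (j = b) * M a a) = det_on M"
proof -
  obtain a' b' where a': "a' < N" "f a' = a" and b': "b' < N" "f b' = b"
    using assms bij by (auto simp: bij_betw_def)
  with assms have ne: "a' \<noteq> b'" "b' \<noteq> a'" by auto
  let ?A = "mat N N (\<lambda>(i, j). M (f i) (f j))"
  have "det (addcol 1 b' a' (addrow 1 b' a' ?A)) = det ?A"
    by (subst det_addcol[of _ N], use a' ne in \<open>auto intro!: det_addrow[of _ N]\<close>)
  also have "addcol 1 b' a' (addrow 1 b' a' ?A) = mat N N (\<lambda>(i, j). M (f i) (f j)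
    + of_bool (f i = b) * M a (f j) + of_bool (f j = b) * M (f i) a
             + of_bool (f i = b) * of_bool (f j = b) * M a a)"
    by (rule eq_matI) (use a' b' ne in \<open>auto simp: f_eq_iff[of _ b', unfolded b']\<close>)
  finally show ?thesis by (simp add: det_on_def)
qed

text \<open>Deletion-contraction for one edge. Adding row and column \<open>a\<close> to those of
  \<open>b\<close> turns the form of \<open>e_a - e_b\<close> into a single 1 at (a, a); expanding
  there leaves \<open>M\<close> (edge deleted) and the matrix with \<open>a\<close> absorbed into
  \<open>b\<close> (edge contracted).\<close>

lemma det_on_add_edge:
  assumes "a \<in> V" "b \<in> V" "a \<noteq> b"
  shows "det_on (\<lambda>i j. M i j + edge_form {a, b} i j) = det_on M + det_on (merge_matrix a b M)"
proof -
  obtain a' where a': "a' < N" "f a' = a"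
    using assms bij by (auto simp: bij_betw_def)
  let ?P = "\<lambda>M i j. M i j + of_bool (i = b) * M a j + of_bool (j = b) * M i a
             + of_bool (i = b) * of_bool (j = b) * (M a a :: int)"
  let ?A = "mat N N (\<lambda>(i, j). ?P M (f i) (f j))"
  have "det_on (\<lambda>i j. M i j + edge_form {a, b} i j) = det_on (?P (\<lambda>i j. M i j + edge_form {a, b} i j))"
    by (rule det_on_add_row_col[symmetric]) fact+
  also have "\<dots> = det_on (\<lambda>i j. ?P M i j + of_bool (i = a) * of_bool (j = a))"
    by (rule det_on_cong) (use assms in \<open>auto simp: edge_form_pair\<close>)
  also have "\<dots> = det (mat N N (\<lambda>(i, j). ?A $$ (i, j) + of_bool (i = a') * of_bool (j = a')))"
    unfolding det_on_def
    by (intro arg_cong[where f = det] eq_matI) (use a' in \<open>auto simp: f_eq_iff[of _ a', unfolded a']\<close>)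
  also have "\<dots> = det ?A + det (mat N N (\<lambda>(i, j). if i = a' \<or> j = a' then of_bool (i = j) else ?A $$ (i, j)))"
    by (rule det_add_unit_entry) (use a' in auto)
  also have "det ?A = det_on M"
    using det_on_add_row_col[OF assms] by (simp add: det_on_def)
  also have "det (mat N N (\<lambda>(i, j). if i = a' \<or> j = a' then of_bool (i = j) else ?A $$ (i, j))) =
      det_on (merge_matrix a b M)"
    unfolding det_on_def merge_matrix_def
    by (intro arg_cong[where f = det] eq_matI) (use a' in \<open>auto simp: f_eq_iff f_eq_iff[of _ a', unfolded a']\<close>)
  finally show ?thesis .
qed

end

section \<open>Forests and their components under insertion of an edge\<close>

abbreviation graph_of :: "'a set \<Rightarrow> 'a set set \<Rightarrow> 'a ugraph" where
  "graph_of V E \<equiv> \<lparr>uverts = V, uedges = E\<rparr>"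

abbreviation linked :: "'a set set \<Rightarrow> ('a \<times> 'a) set" where
  "linked E \<equiv> {(u, v). {u, v} \<in> E}\<^sup>*"

lemma acyclic_mono: "acyclic_ugraph (graph_of V E) \<Longrightarrow> E' \<subseteq> E \<Longrightarrow> acyclic_ugraph (graph_of V E')"
  unfolding acyclic_ugraph_def cycle_of_ugraph_def by (simp add: subset_iff) blast

lemma acyclic_empty: "acyclic_ugraph (graph_of V {})"
  by (force simp: acyclic_ugraph_def cycle_of_ugraph_def)

lemma linked_sym: "(x, y) \<in> linked E \<longleftrightarrow> (y, x) \<in> linked E"
proof -
  have "sym (linked E)" by (intro sym_rtrancl) (auto simp: sym_def insert_commute)
  thus ?thesis by (auto simp: sym_def)
qed

text \<open>The new edge closes a simple path from \<open>u\<close> to \<open>v\<close> inside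
  \<open>D\<close>. This path has at least two edges because {u, v} itself is not in
  \<open>D\<close>, so the cycle has at least three vertices.\<close>

lemma not_acyclic_insert:
  assumes "u \<noteq> v" "{u, v} \<notin> D" "(u, v) \<in> linked D"
  shows "\<not> acyclic_ugraph (graph_of V (insert {u, v} D))"
proof -
  let ?r = "\<lambda>x y. {x, y} \<in> D"
  have "?r\<^sup>*\<^sup>* u v"
    using assms(3) by (simp add: rtranclp_rtrancl_eq)
  then obtain xs0 where "rtrancl_path ?r u xs0 v"
    by (auto simp: rtranclp_eq_rtrancl_path)
  then obtain xs where xs: "rtrancl_path ?r u xs v" "distinct (u # xs)"
    by (rule rtrancl_path_distinct)
  have ne: "xs \<noteq> []" using xs(1) assms(1) by (auto elim: rtrancl_path.cases)
  have last: "last xs = v" using rtrancl_path_last[OF xs(1) ne] .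
  have edge: "{(u # xs) ! i, xs ! i} \<in> D" if "i < length xs" for i
    using rtrancl_path_nth[OF xs(1) that] .
  have "length xs \<noteq> 1"
  proof
    assume "length xs = 1"
    then obtain y where "xs = [y]" by (auto simp: length_Suc_conv)
    thus False using edge[of 0] last assms(2) by simp
  qed
  hence len: "2 \<le> length xs" using ne by (cases "length xs") auto
  have "{(u # xs) ! i, (u # xs) ! (Suc i mod length (u # xs))} \<in> insert {u, v} D"
    if "i < length (u # xs)" for i
  proof (cases "i = length xs")
    case True
    hence "(u # xs) ! i = v" using last ne by (simp add: last_conv_nth nth_Cons')
    thus ?thesis using True by (simp add: insert_commute)
  next
    case False
    thus ?thesis using that edge[of i] by simp
  qed
  hence "cycle_of_ugraph (graph_of V (insert {u, v} D)) (u # xs)"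
    using len xs(2) by (simp add: cycle_of_ugraph_def)
  thus ?thesis by (auto simp: acyclic_ugraph_def)
qed

text \<open>A new cycle must run through {u, v}, and only once; the rest of it joins
  \<open>u\<close> to \<open>v\<close> inside \<open>D\<close>.\<close>

lemma acyclic_insert:
  assumes "acyclic_ugraph (graph_of V D)" "(u, v) \<notin> linked D"
  shows "acyclic_ugraph (graph_of V (insert {u, v} D))"
proof -
  have False if cyc: "cycle_of_ugraph (graph_of V (insert {u, v} D)) p" for p
  proof -
    define L where "L = length p"
    have L: "3 \<le> L" and dist: "distinct p"
      and edge: "\<And>i. i < L \<Longrightarrow> {p ! i, p ! (Suc i mod L)} \<in> insert {u, v} D"
      using cyc by (auto simp: cycle_of_ugraph_def L_def)
    have nth_eq: "p ! i = p ! j \<longleftrightarrow> i = j" if "i < L" "j < L" for i j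
      using that dist by (simp add: nth_eq_iff_index_eq L_def)
    obtain i where i: "i < L" "{p ! i, p ! (Suc i mod L)} \<notin> D"
      using assms(1) L dist unfolding acyclic_ugraph_def cycle_of_ugraph_def L_def by auto
    hence i': "{p ! i, p ! (Suc i mod L)} = {u, v}" using edge by blast
    \<comment> \<open>Distinct positions carry distinct edges. In a cycle of length 2 both positions
      would carry the same edge, so \<open>3 \<le> L\<close> matters here.\<close>
    have other: "{p ! j, p ! (Suc j mod L)} \<in> D" if j: "j < L" "j \<noteq> i" for j
    proof -
      have "{p ! j, p ! (Suc j mod L)} \<noteq> {p ! i, p ! (Suc i mod L)}"
        using j i(1) L by (auto simp: doubleton_eq_iff nth_eq mod_Suc split: if_splits)
      thus ?thesis using edge[OF j(1)] i' by auto
    qed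
    \<comment> \<open>Going round from the far end of the new edge, position \<open>i\<close> is
      reached after \<open>L - 1\<close> steps and not before, so every edge used on the way lies in
      \<open>D\<close>.\<close>
    have "(p ! (Suc i mod L), p ! ((Suc i + k) mod L)) \<in> linked D" if "k < L" for k
      using that
    proof (induction k)
      case (Suc k)
      have "(Suc i + k) mod L \<noteq> i"
      proof
        assume eq: "(Suc i + k) mod L = i"
        have "(i + Suc k) mod L = i mod L" using eq i(1) by simp
        hence "L dvd Suc k" by (simp add: mod_eq_dvd_iff_nat)
        thus False using Suc.prems by (auto dest: dvd_imp_le)
      qed
      hence "{p ! ((Suc i + k) mod L), p ! (Suc ((Suc i + k) mod L) mod L)} \<in> D"
        using L by (intro other) auto
      hence "(p ! ((Suc i + k) mod L), p ! ((Suc i + Suc k) mod L)) \<in> {(u, v). {u, v} \<in> D}"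
        by (simp add: mod_Suc_eq)
      moreover have "(p ! (Suc i mod L), p ! ((Suc i + k) mod L)) \<in> linked D"
        using Suc by simp
      ultimately show ?case by (rule rtrancl_into_rtrancl[rotated])
    qed auto
    from this[of "L - 1"] have "(p ! (Suc i mod L), p ! i) \<in> linked D"
      using L i(1) by simp
    hence "(u, v) \<in> linked D"
      using i' linked_sym[of u v D] by (auto simp: doubleton_eq_iff)
    thus False using assms(2) by contradiction
  qed
  thus ?thesis by (auto simp: acyclic_ugraph_def)
qed

text \<open>A contraction is recorded by sending every vertex to a chosen vertex of its component;
  the contracted graph then has some of the old vertices as its vertices.\<close>

definition represents :: "'a set \<Rightarrow> 'a set set \<Rightarrow> ('a \<Rightarrow> 'a) \<Rightarrow> bool" where
  "represents V D rep \<longleftrightarrow>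
     (\<forall>x\<in>V. rep x \<in> V \<and> rep (rep x) = rep x \<and> (\<forall>y\<in>V. (x, y) \<in> linked D \<longleftrightarrow> rep x = rep y))"

lemma linked_insert:
  "(x, y) \<in> linked (insert {u, v} D) \<longleftrightarrow>
     (x, y) \<in> linked D \<or> (x, u) \<in> linked D \<and> (v, y) \<in> linked D \<or> (x, v) \<in> linked D \<and> (u, y) \<in> linked D"
proof -
  have "{(x, y). {x, y} \<in> insert {u, v} D} = insert (u, v) (insert (v, u) {(x, y). {x, y} \<in> D})"
    by (auto simp: doubleton_eq_iff)
  thus ?thesis by (auto simp: rtrancl_insert intro: rtrancl_trans)
qed

lemma represents_insert:
  assumes rep: "represents V D rep" and uv: "u \<in> V" "v \<in> V" "rep u \<noteq> rep v"
  shows "represents V (insert {u, v} D) (\<lambda>x. if rep x = rep u then rep v else rep x)"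
  unfolding represents_def linked_insert
  using assms by (auto simp: represents_def)

text \<open>The components are the fibres of \<open>rep\<close>. Indexing them by fixed points turns
  a product over components into a product of diagonal entries.\<close>

lemma components_represented:
  assumes "represents V D rep"
  shows "bij_betw (\<lambda>r. {v \<in> V. rep v = r}) {r \<in> V. rep r = r} (components_of_ugraph (graph_of V D))"
proof -
  have "reach_rel (graph_of V D) `` {x} = {v \<in> V. rep v = rep x}" if "x \<in> V" for x
    using assms that by (auto simp: reach_rel_def represents_def)
  hence eq: "components_of_ugraph (graph_of V D) = (\<lambda>x. {v \<in> V. rep v = rep x}) ` V"
    by (auto simp: components_of_ugraph_def quotient_def)
  have "(\<lambda>x. {v \<in> V. rep v = rep x}) ` V = (\<lambda>r. {v \<in> V. rep v = r}) ` {r \<in> V. rep r = r}"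
  proof safe
    fix x assume "x \<in> V"
    thus "{v \<in> V. rep v = rep x} \<in> (\<lambda>r. {v \<in> V. rep v = r}) ` {r \<in> V. rep r = r}"
      using assms by (intro image_eqI[of _ _ "rep x"]) (auto simp: represents_def)
  next
    fix r assume "r \<in> V" "rep r = r"
    thus "{v \<in> V. rep v = r} \<in> (\<lambda>x. {v \<in> V. rep v = rep x}) ` V"
      by (intro image_eqI[of _ _ r]) auto
  qed
  moreover have "inj_on (\<lambda>r. {v \<in> V. rep v = r}) {r \<in> V. rep r = r}"
    by (rule inj_onI) (simp add: set_eq_iff, metis)
  ultimately show ?thesis by (simp add: bij_betw_def eq)
qed

text \<open>A set meeting every block exactly once is the range of exactly one choice function. For
  the components of a forest this counts the choices of roots.\<close>

lemma card_transversals: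
  assumes fin: "finite P" "\<And>C. C \<in> P \<Longrightarrow> finite C" and disj: "disjoint P" and V: "\<Union>P = V"
  shows "card {W. W \<subseteq> V \<and> (\<forall>C\<in>P. \<exists>!v. v \<in> W \<inter> C)} = (\<Prod>C\<in>P. card C)"
proof -
  have image: "g ` P \<inter> C = {g C}" if "g \<in> (\<Pi>\<^sub>E C\<in>P. C)" "C \<in> P" for g C
  proof (intro equalityI subsetI)
    fix x assume "x \<in> g ` P \<inter> C"
    then obtain C' where C': "C' \<in> P" "x = g C'" "x \<in> C" by blast
    moreover have "g C' \<in> C'" using that C' by (auto simp: PiE_iff)
    ultimately have "C' = C" using disj that by (auto simp: disjoint_def)
    thus "x \<in> {g C}" using C' by simp
  qed (use that in \<open>auto simp: PiE_iff\<close>)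
  have "bij_betw (\<lambda>g. g ` P) (\<Pi>\<^sub>E C\<in>P. C) {W. W \<subseteq> V \<and> (\<forall>C\<in>P. \<exists>!v. v \<in> W \<inter> C)}"
  proof (intro bij_betw_imageI)
    show "inj_on (\<lambda>g. g ` P) (\<Pi>\<^sub>E C\<in>P. C)"
    proof (rule inj_onI)
      fix g h assume gh: "g \<in> (\<Pi>\<^sub>E C\<in>P. C)" "h \<in> (\<Pi>\<^sub>E C\<in>P. C)" "g ` P = h ` P"
      have "g C = h C" if "C \<in> P" for C
        using image[OF gh(1) that] image[OF gh(2) that] gh(3) by simp
      thus "g = h"
        using gh(1,2) by (intro extensionalityI[of _ P]) (auto simp: PiE_def)
    qed
    show "(\<lambda>g. g ` P) ` (\<Pi>\<^sub>E C\<in>P. C) = {W. W \<subseteq> V \<and> (\<forall>C\<in>P. \<exists>!v. v \<in> W \<inter> C)}"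
    proof (intro equalityI subsetI)
      fix W assume "W \<in> (\<lambda>g. g ` P) ` (\<Pi>\<^sub>E C\<in>P. C)"
      then obtain g where g: "g \<in> (\<Pi>\<^sub>E C\<in>P. C)" "W = g ` P" by blast
      have "W \<subseteq> V" using g V by (auto simp: PiE_iff)
      moreover have "\<exists>!v. v \<in> W \<inter> C" if "C \<in> P" for C
        using image[OF g(1) that] by (simp add: g(2))
      ultimately show "W \<in> {W. W \<subseteq> V \<and> (\<forall>C\<in>P. \<exists>!v. v \<in> W \<inter> C)}" by blast
    next
      fix W assume "W \<in> {W. W \<subseteq> V \<and> (\<forall>C\<in>P. \<exists>!v. v \<in> W \<inter> C)}"
      hence W: "W \<subseteq> V" "\<forall>C\<in>P. \<exists>!v. v \<in> W \<inter> C" by auto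
      define g where "g = (\<lambda>C\<in>P. THE v. v \<in> W \<inter> C)"
      have g: "g C \<in> W \<inter> C" if "C \<in> P" for C
        using theI'[OF W(2)[rule_format, OF that]] that by (simp add: g_def)
      have "W = g ` P"
      proof safe
        fix v assume v: "v \<in> W"
        then obtain C where C: "C \<in> P" "v \<in> C" using W(1) V by auto
        have "v = g C" using W(2) g[OF C(1)] v C by blast
        thus "v \<in> g ` P" using C by simp
      qed (use g in auto)
      moreover have "g \<in> (\<Pi>\<^sub>E C\<in>P. C)" using g by (auto simp: PiE_iff g_def)
      ultimately show "W \<in> (\<lambda>g. g ` P) ` (\<Pi>\<^sub>E C\<in>P. C)" by blast
    qed
  qed
  from bij_betw_same_card[OF this] show ?thesis
    by (simp add: card_PiE fin)
qed

text \<open>\<open>I + L\<close> after contraction. Merging adds up the ones of \<open>I\<close>, so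
  a surviving vertex carries the size of its fibre; the other vertices keep a unit row and column.
  Edges inside a fibre have become loops and drop out.\<close>

definition contracted :: "'a set \<Rightarrow> ('a \<Rightarrow> 'a) \<Rightarrow> 'a set set \<Rightarrow> 'a \<Rightarrow> 'a \<Rightarrow> int" where
  "contracted V rep E i j =
     (if rep i = i \<and> rep j = j
      then of_bool (i = j) * int (card {v \<in> V. rep v = i}) + (\<Sum>e\<in>E. edge_form (rep ` e) i j)
      else of_bool (i = j))"

definition forest_weight :: "'a set \<Rightarrow> 'a set set \<Rightarrow> int" where
  "forest_weight V F = (\<Prod>C\<in>components_of_ugraph (graph_of V F). int (card C))"

text \<open>The fibre of \<open>a\<close> joins that of \<open>b\<close>. Fibre sizes add up, and
  the edge forms, being products of differences of indicators, follow the indicators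
  bilinearly.\<close>

lemma merge_contracted:
  assumes fin: "finite V" and rep: "represents V D rep" and ab: "a \<in> V" "b \<in> V" "rep a = a" "rep b = b" "a \<noteq> b"
    and E: "\<And>e. e \<in> E \<Longrightarrow> \<exists>p q. e = {p, q}" and ij: "i \<in> V" "j \<in> V"
  shows "merge_matrix a b (contracted V rep E) i j =
         contracted V (\<lambda>x. if rep x = a then b else rep x) E i j"
proof (cases "i = a \<or> j = a")
  case True
  thus ?thesis using ab by (auto simp: merge_matrix_def contracted_def)
next
  case False
  define rep' where "rep' = (\<lambda>x. if rep x = a then b else rep x)"
  have eq_rep': "rep' i = i \<longleftrightarrow> rep i = i" if "i \<noteq> a" for i
    using that ab by (auto simp: rep'_def)
  show ?thesis
  proof (cases "rep i = i \<and> rep j = j")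
    case True
    have form: "edge_form (rep' ` e) i j = edge_form (rep ` e) i j
        + of_bool (i = b) * edge_form (rep ` e) a j + of_bool (j = b) * edge_form (rep ` e) i a
        + of_bool (i = b) * of_bool (j = b) * edge_form (rep ` e) a a" if "e \<in> E" for e
    proof -
      from E[OF that] obtain p q where e: "e = {p, q}" by blast
      \<comment> \<open>The only change of an indicator: what was represented by \<open>a\<close>
        now counts for \<open>b\<close>.\<close>
      have *: "(of_bool (k = rep' x) :: int) = of_bool (k = rep x) + of_bool (k = b) * of_bool (a = rep x)"
        if "k \<noteq> a" for k x using that ab by (auto simp: rep'_def)
      show ?thesis
        using False by (simp add: e edge_form_pair * ring_distribs)
    qed
    have "{v \<in> V. rep' v = b} = {v \<in> V. rep v = b} \<union> {v \<in> V. rep v = a}"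
      using ab by (auto simp: rep'_def)
    hence cardb: "card {v \<in> V. rep' v = b} = card {v \<in> V. rep v = b} + card {v \<in> V. rep v = a}"
      using fin ab by (simp add: card_Un_disjoint disjoint_iff)
    have card: "card {v \<in> V. rep' v = k} = card {v \<in> V. rep v = k}" if "k \<noteq> a" "k \<noteq> b" for k
      using that by (intro arg_cong[where f = card]) (auto simp: rep'_def)
    have sum: "(\<Sum>e\<in>E. edge_form (rep' ` e) i j) = (\<Sum>e\<in>E. edge_form (rep ` e) i j)
        + of_bool (i = b) * (\<Sum>e\<in>E. edge_form (rep ` e) a j) + of_bool (j = b) * (\<Sum>e\<in>E. edge_form (rep ` e) i a)
        + of_bool (i = b) * of_bool (j = b) * (\<Sum>e\<in>E. edge_form (rep ` e) a a)"
      by (simp add: form sum.distrib sum_distrib_left)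
    show ?thesis
      unfolding rep'_def[symmetric]
      using False True ab cardb card
      by (auto simp: merge_matrix_def contracted_def eq_rep' sum)
  next
    case nonrep: False
    thus ?thesis unfolding rep'_def[symmetric]
      using False ab by (auto simp: merge_matrix_def contracted_def eq_rep')
  qed
qed

section \<open>Deletion-contraction and the count of rooted forests\<close>

context finite_enum begin

lemma det_on_contracted_empty:
  assumes "represents V D rep"
  shows "det_on (contracted V rep {}) = forest_weight V D"
proof -
  have "det_on (contracted V rep {}) =
      det_on (\<lambda>i j. if i = j then if rep i = i then int (card {v \<in> V. rep v = i}) else 1 else 0)"
    by (rule det_on_cong) (auto simp: contracted_def)
  also have "\<dots> = (\<Prod>i\<in>V. if rep i = i then int (card {v \<in> V. rep v = i}) else 1)"
    by (rule det_on_diag)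
  also have "\<dots> = (\<Prod>i\<in>{i \<in> V. rep i = i}. int (card {v \<in> V. rep v = i}))"
    by (rule prod.inter_filter[symmetric]) simp
  also have "\<dots> = forest_weight V D"
    unfolding forest_weight_def by (rule prod.reindex_bij_betw[OF components_represented[OF assms]])
  finally show ?thesis .
qed

text \<open>
  Deletion-contraction: the edges of \<open>D\<close> have been contracted, those of \<open>E\<close> are still undecided.
\<close>

lemma det_on_contracted:
  assumes "finite E" "\<And>e. e \<in> E \<Longrightarrow> e \<subseteq> V \<and> card e = 2" "D \<inter> E = {}"
    "acyclic_ugraph (graph_of V D)" "represents V D rep"
  shows "det_on (contracted V rep E) =
         (\<Sum>F | F \<subseteq> E \<and> acyclic_ugraph (graph_of V (D \<union> F)). forest_weight V (D \<union> F))"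
  using assms
proof (induction E arbitrary: D rep rule: finite_induct)
  case empty
  have "{F. F = {} \<and> acyclic_ugraph (graph_of V (D \<union> F))} = {{}}" using empty by auto
  thus ?case using det_on_contracted_empty empty by simp
next
  case (insert e E)
  obtain u v where e: "e = {u, v}" and uv: "u \<noteq> v" "u \<in> V" "v \<in> V"
    using insert.prems(1)[of e] by (auto simp: card_2_iff)
  have pairs: "\<exists>p q. e = {p, q}" if "e \<in> E" for e
    using insert.prems(1)[of e] that by (auto simp: card_2_iff)
  have eD: "{u, v} \<notin> D" using insert.prems(2) e by auto
  have repV: "rep x \<in> V" "rep (rep x) = rep x" if "x \<in> V" for x
    using insert.prems(4) that by (auto simp: represents_def)
  have linked: "(u, v) \<in> linked D \<longleftrightarrow> rep u = rep v"
    using insert.prems(4) uv by (simp add: represents_def)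
  let ?A = "\<lambda>E D. {F. F \<subseteq> E \<and> acyclic_ugraph (graph_of V (D \<union> F))}"
  let ?w = "\<lambda>D F. forest_weight V (D \<union> F)"
  have finA: "finite (?A E D')" for D'
    using insert.hyps(1) by (auto intro: finite_subset[of _ "Pow E"])
  have IH: "det_on (contracted V rep E) = sum (?w D) (?A E D)"
    by (rule insert.IH) (use insert.prems in auto)
  show ?case
  proof (cases "rep u = rep v")
    case True
    \<comment> \<open>Here \<open>e\<close> closes a cycle with \<open>D\<close>, so no forest in
      the sum contains it; correspondingly its image is a loop and leaves the matrix
      unchanged.\<close>
    have "\<not> acyclic_ugraph (graph_of V (D \<union> F))" if "e \<in> F" for F
      using not_acyclic_insert[OF uv(1) eD] acyclic_mono[of V "D \<union> F" "insert {u, v} D"]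
        linked True that e by auto
    hence "?A (insert e E) D = ?A E D" by auto
    moreover have "contracted V rep (insert e E) = contracted V rep E"
      using True insert.hyps by (intro ext) (simp add: contracted_def e edge_form_def)
    ultimately show ?thesis using IH by simp
  next
    case False
    let ?rep' = "\<lambda>x. if rep x = rep u then rep v else rep x"
    have "det_on (contracted V rep (insert e E)) =
        det_on (\<lambda>i j. contracted V rep E i j + edge_form {rep u, rep v} i j)"
      by (rule det_on_cong) (use insert.hyps uv repV in \<open>auto simp: contracted_def e edge_form_pair\<close>)
    also have "\<dots> = det_on (contracted V rep E) + det_on (merge_matrix (rep u) (rep v) (contracted V rep E))"
      by (rule det_on_add_edge) (use repV uv False in auto)
    also have "det_on (merge_matrix (rep u) (rep v) (contracted V rep E)) = det_on (contracted V ?rep' E)"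
      by (intro det_on_cong merge_contracted[OF _ insert.prems(4)]) (use repV uv False pairs in auto)
    also have "\<dots> = sum (?w (insert e D)) (?A E (insert e D))"
    proof (rule insert.IH)
      show "acyclic_ugraph (graph_of V (insert e D))"
        unfolding e by (rule acyclic_insert) (use insert.prems False linked in auto)
      show "represents V (insert e D) ?rep'"
        unfolding e by (rule represents_insert) (use insert.prems False uv in auto)
    qed (use insert.prems insert.hyps in auto)
    \<comment> \<open>Forests through \<open>e\<close> are re-indexed: \<open>e\<close> moves from
      the contracted edges back into \<open>F\<close>.\<close>
    also have "\<dots> = sum (?w D) (insert e ` ?A E (insert e D))"
    proof (subst sum.reindex)
      show "inj_on (insert e) (?A E (insert e D))"
        using insert.hyps(2) by (auto simp: inj_on_def)
    qed simp
    also have "det_on (contracted V rep E) + sum (?w D) (insert e ` ?A E (insert e D)) =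
        sum (?w D) (?A E D \<union> insert e ` ?A E (insert e D))"
      unfolding IH by (rule sum.union_disjoint[symmetric]) (use finA insert.hyps in auto)
    also have "?A E D \<union> insert e ` ?A E (insert e D) = ?A (insert e E) D"
    proof (intro equalityI subsetI)
      fix F assume F: "F \<in> ?A (insert e E) D"
      show "F \<in> ?A E D \<union> insert e ` ?A E (insert e D)"
      proof (cases "e \<in> F")
        case True
        hence "F = insert e (F - {e})" "insert e D \<union> (F - {e}) = D \<union> F" by auto
        thus ?thesis using F by (intro UnI2 image_eqI[of _ _ "F - {e}"]) auto
      qed (use F in auto)
    qed auto
    finally show ?thesis .
  qed
qed

text \<open>A rooted forest is an acyclic edge set with a transversal of its components, so each
  edge set counts with weight \<open>forest_weight\<close>. Deletion-contraction starts from
  \<open>D = {}\<close> and \<open>rep = id\<close>, where all fibres are singletons and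
  \<open>contracted\<close> is \<open>I + L\<close>.\<close>

theorem matrix_forest:
  assumes G: "simple_ugraph G" "uverts G = V"
  shows "int (num_rooted_spanning_forests G) =
         det_on (\<lambda>i j. of_bool (i = j) + (\<Sum>e\<in>uedges G. edge_form e i j))"
proof -
  let ?E = "uedges G"
  let ?A = "{F. F \<subseteq> ?E \<and> acyclic_ugraph (graph_of V F)}"
  let ?W = "\<lambda>F. {W. W \<subseteq> V \<and> (\<forall>C\<in>components_of_ugraph (graph_of V F). \<exists>!v. v \<in> W \<inter> C)}"
  have E: "e \<subseteq> V \<and> card e = 2" if "e \<in> ?E" for e
    using that G by (auto simp: simple_ugraph_def)
  hence finE: "finite ?E" by (intro finite_subset[of ?E "Pow V"]) auto
  hence finA: "finite ?A" by (auto intro: finite_subset[of _ "Pow ?E"])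
  have "rooted_spanning_forests G = (\<lambda>(F, W). (graph_of V F, W)) ` Sigma ?A ?W"
  proof (intro equalityI subsetI)
    fix X assume X: "X \<in> rooted_spanning_forests G"
    obtain F W where FW: "X = (F, W)" by fastforce
    have "uverts F = V" using X FW G(2) by (simp add: rooted_spanning_forests_def)
    hence "F = graph_of V (uedges F)" by simp
    then obtain D where "F = graph_of V D" by blast
    thus "X \<in> (\<lambda>(F, W). (graph_of V F, W)) ` Sigma ?A ?W"
      using X by (intro image_eqI[of _ _ "(D, W)"]) (auto simp: FW rooted_spanning_forests_def sub_ugraph_def)
  next
    fix X assume "X \<in> (\<lambda>(F, W). (graph_of V F, W)) ` Sigma ?A ?W"
    then obtain F W where "X = (graph_of V F, W)" "F \<in> ?A" "W \<in> ?W F" by auto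
    moreover from this have "\<forall>e\<in>F. e \<subseteq> V" using E by blast
    ultimately show "X \<in> rooted_spanning_forests G"
      using G(2) by (simp add: rooted_spanning_forests_def sub_ugraph_def)
  qed
  moreover have "inj_on (\<lambda>(F, W). (graph_of V F, W)) (Sigma ?A ?W)"
    by (auto simp: inj_on_def)
  ultimately have "num_rooted_spanning_forests G = (\<Sum>F\<in>?A. card (?W F))"
    unfolding num_rooted_spanning_forests_def
    by (simp add: card_image card_SigmaI finA)
  also have "\<dots> = (\<Sum>F\<in>?A. \<Prod>C\<in>components_of_ugraph (graph_of V F). card C)"
  proof (intro sum.cong refl card_transversals)
    fix F
    have eq: "equiv V (reach_rel (graph_of V F))"
      by (intro equivI) (auto simp: reach_rel_def refl_on_def sym_def trans_def linked_sym intro: rtrancl_trans)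
    show "finite (components_of_ugraph (graph_of V F))"
      unfolding components_of_ugraph_def by (rule finite_quotient) (auto simp: reach_rel_def)
    show "\<Union>(components_of_ugraph (graph_of V F)) = V"
      using Union_quotient[OF eq] by (simp add: components_of_ugraph_def)
    show "finite C" if "C \<in> components_of_ugraph (graph_of V F)" for C
      using finite_equiv_class[of V "reach_rel (graph_of V F)" C] that
      by (auto simp: components_of_ugraph_def reach_rel_def)
    show "disjoint (components_of_ugraph (graph_of V F))"
      using quotient_disj[OF eq] by (auto simp: components_of_ugraph_def disjoint_def)
  qed
  finally have "int (num_rooted_spanning_forests G) = (\<Sum>F\<in>?A. forest_weight V F)"
    by (simp add: forest_weight_def)
  also have "\<dots> = det_on (contracted V id ?E)"
    using det_on_contracted[of ?E "{}" id] finE E by (simp add: acyclic_empty represents_def)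
  also have "\<dots> = det_on (\<lambda>i j. of_bool (i = j) + (\<Sum>e\<in>?E. edge_form e i j))"
    by (rule det_on_cong) (auto simp: contracted_def Collect_conv_if)
  finally show ?thesis .
qed

end

section \<open>Determinants of symmetric circulant matrices\<close>

lemma sum_lessThan_add: "(\<Sum>i<m + r. F i) = (\<Sum>i<m. F i) + (\<Sum>i<r. F (m + i :: nat) :: 'a :: comm_monoid_add)"
  by (induction r) (simp_all add: add.assoc)

text \<open>\<open>(n - 1) div 2\<close> is the number of pairs {k, -k} of distinct residues; left
  over are 0 and, for even \<open>n\<close>, also \<open>n div 2\<close>.\<close>

lemma half_pred_cases:
  fixes n :: nat
  assumes "0 < n"
  obtains "odd n" "n = (n - 1) div 2 + (n - 1) div 2 + 1"
    | "even n" "n = (n - 1) div 2 + (n - 1) div 2 + 2" "n - 1 = (n - 1) div 2 + (n - 1) div 2 + 1"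
proof (cases "even n")
  case True
  then obtain k where "n = 2 * k" by (rule evenE)
  with assms obtain k' where "n = 2 * k' + 2" by (cases k) auto
  thus ?thesis by (intro that(2)) auto
next
  case False
  then obtain k where "n = 2 * k + 1" by (rule oddE)
  thus ?thesis by (intro that(1)) auto
qed

lemma column_cases:
  fixes c n m :: nat
  assumes c: "c < n" and m: "m = (n - 1) div 2"
  obtains "c < m" | j where "j < m" "c = m + j" | "c = 2 * m" | "even n" "c = n - 1" "c = 2 * m + 1"
proof -
  from c have "0 < n" by simp
  hence "n = m + m + 1 \<or> even n \<and> n = m + m + 2"
    by (cases rule: half_pred_cases) (unfold m[symmetric], simp_all)
  hence "c < m \<or> c - m < m \<and> c = m + (c - m) \<or> c = 2 * m \<or> even n \<and> c = n - 1 \<and> c = 2 * m + 1"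
    using c by linarith
  thus ?thesis using that by blast
qed

text \<open>Functions on the residues are represented by periodic functions on all integers, so that
  shifts and reflections need no reduction of the argument.\<close>

definition periodic :: "nat \<Rightarrow> (int \<Rightarrow> 'a) \<Rightarrow> bool" where
  "periodic n g \<longleftrightarrow> (\<forall>k. g (k mod int n) = g k)"

lemma periodic_cong: "periodic n g \<Longrightarrow> x mod int n = y mod int n \<Longrightarrow> g x = g y"
  unfolding periodic_def by metis

lemma periodic_shift: "periodic n g \<Longrightarrow> periodic n (\<lambda>k. g (k + c))"
  unfolding periodic_def[of n "\<lambda>k. g (k + c)"] by (auto intro: periodic_cong simp: mod_add_left_eq)

lemma periodic_reflect: "periodic n g \<Longrightarrow> periodic n (\<lambda>k. g (c - k))"
  unfolding periodic_def[of n "\<lambda>k. g (c - k)"] by (auto intro: periodic_cong simp: mod_diff_right_eq)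

lemma periodic_comp2: "periodic n g \<Longrightarrow> periodic n h \<Longrightarrow> periodic n (\<lambda>k. F (g k) (h k))"
  by (simp add: periodic_def)

lemma periodic_const: "periodic n (\<lambda>k. c)"
  by (simp add: periodic_def)

lemma periodic_sum: "(\<And>x. x \<in> X \<Longrightarrow> periodic n (g x)) \<Longrightarrow> periodic n (\<lambda>k. \<Sum>x\<in>X. g x k)"
  by (simp add: periodic_def)

lemma sum_int_lessThan: "(\<Sum>j<n. F (int j)) = (\<Sum>k\<in>{0..<int n}. F k)"
  by (rule sum.reindex_bij_witness[of _ nat int]) auto

lemma sum_shift:
  fixes g :: "int \<Rightarrow> int"
  assumes "0 < n" "periodic n g"
  shows "(\<Sum>k\<in>{0..<int n}. g (k + c)) = (\<Sum>k\<in>{0..<int n}. g k)"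
  by (rule sum.reindex_bij_witness[of _ "\<lambda>k. (k - c) mod int n" "\<lambda>k. (k + c) mod int n"])
    (use assms in \<open>auto simp: mod_diff_left_eq mod_add_left_eq periodic_def\<close>)

lemma sum_reflect:
  fixes g :: "int \<Rightarrow> int"
  assumes "0 < n" "periodic n g"
  shows "(\<Sum>k\<in>{0..<int n}. g (c - k)) = (\<Sum>k\<in>{0..<int n}. g k)"
  by (rule sum.reindex_bij_witness[of _ "\<lambda>k. (c - k) mod int n" "\<lambda>k. (c - k) mod int n"])
    (use assms in \<open>auto simp: mod_diff_right_eq periodic_def\<close>)

section \<open>Circulant matrices and their action on odd functions\<close>

definition circulant :: "nat \<Rightarrow> (int \<Rightarrow> int) \<Rightarrow> int mat" where
  "circulant n a = mat n n (\<lambda>(i, j). a (int j - int i))"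

lemma circulant_carrier [simp]: "circulant n a \<in> carrier_mat n n"
  by (simp add: circulant_def)

definition alternating :: "int \<Rightarrow> int" where
  "alternating k = (if even k then 1 else -1)"

lemma alternating_add: "alternating (x + y) = alternating x * alternating y"
  by (auto simp: alternating_def)

lemma alternating_minus: "alternating (- x) = alternating x"
  by (auto simp: alternating_def)

lemma periodic_alternating: "even n \<Longrightarrow> periodic n alternating"
  by (auto simp: periodic_def alternating_def dvd_mod_iff)

text \<open>Signed indicator of the residues j + 1 and -(j + 1). The offset skips 0, where odd
  functions vanish.\<close>

definition odd_basis :: "nat \<Rightarrow> nat \<Rightarrow> int \<Rightarrow> int" where
  "odd_basis n j k = of_bool (k mod int n = int (Suc j)) - of_bool ((- k) mod int n = int (Suc j))"

lemma odd_basis_minus: "odd_basis n j (- k) = - odd_basis n j k"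
  by (simp add: odd_basis_def)

lemma periodic_odd_basis: "periodic n (odd_basis n j)"
  by (simp add: periodic_def odd_basis_def mod_minus_eq)

lemma odd_basis_nth:
  assumes "i < (n - 1) div 2" "j < (n - 1) div 2"
  shows "odd_basis n j (int (Suc i)) = of_bool (i = j)"
proof -
  have "(- int (Suc i)) mod int n = (int n - int (Suc i)) mod int n"
    by (simp add: mod_diff_left_eq)
  also have "\<dots> = int n - int (Suc i)"
    using assms by (intro mod_pos_pos_trivial) auto
  finally have "(- int (Suc i)) mod int n = int n - int (Suc i)" .
  moreover have "int (Suc i) mod int n = int (Suc i)"
    using assms by (intro mod_pos_pos_trivial) auto
  ultimately show ?thesis
    using assms by (auto simp: odd_basis_def)
qed

text \<open>An odd periodic function vanishes at 0 and, for even \<open>n\<close>, at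
  \<open>n div 2\<close>, each being its own negative. Its values at 1, ...,
  \<open>(n - 1) div 2\<close> therefore determine it and are its integer coordinates.\<close>

lemma odd_expansion:
  fixes w :: "int \<Rightarrow> int"
  assumes n: "0 < n" and per: "periodic n w" and odd: "\<And>k. w (- k) = - w k"
  shows "w k = (\<Sum>j<(n - 1) div 2. w (int (Suc j)) * odd_basis n j k)"
proof -
  let ?m = "(n - 1) div 2"
  have delta: "(\<Sum>j<?m. w (int (Suc j)) * of_bool (x mod int n = int (Suc j))) =
      (if 0 < x mod int n \<and> x mod int n \<le> int ?m then w x else 0)" for x
  proof (cases "0 < x mod int n \<and> x mod int n \<le> int ?m")
    case True
    define i where "i = nat (x mod int n) - 1"
    have i: "i < ?m" "x mod int n = int (Suc i)" using True by (auto simp: i_def)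
    have "w x = w (int (Suc i))"
      using per[unfolded periodic_def, rule_format, of x] by (simp only: i(2))
    moreover have "(\<Sum>j<?m. w (int (Suc j)) * of_bool (x mod int n = int (Suc j))) =
        (\<Sum>j<?m. if j = i then w (int (Suc i)) else 0)"
      by (rule sum.cong) (auto simp: i(2))
    ultimately show ?thesis using True i(1) by simp
  next
    case False
    have "(\<Sum>j<?m. w (int (Suc j)) * of_bool (x mod int n = int (Suc j))) = 0"
      by (rule sum.neutral) (use False in auto)
    thus ?thesis using False by auto
  qed
  define y where "y = k mod int n"
  have y: "0 \<le> y" "y < int n" using n by (auto simp: y_def)
  have neg: "(- k) mod int n = (if y = 0 then 0 else int n - y)"
    by (simp add: y_def zmod_zminus1_eq_if)
  have wk: "w k = w y" using per by (simp add: periodic_def y_def)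
  have "(\<Sum>j<?m. w (int (Suc j)) * odd_basis n j k) =
      (\<Sum>j<?m. w (int (Suc j)) * of_bool (k mod int n = int (Suc j))) -
      (\<Sum>j<?m. w (int (Suc j)) * of_bool ((- k) mod int n = int (Suc j)))"
    by (simp only: odd_basis_def right_diff_distrib sum_subtractf)
  also have "\<dots> = (if 0 < k mod int n \<and> k mod int n \<le> int ?m then w k else 0) -
      (if 0 < (- k) mod int n \<and> (- k) mod int n \<le> int ?m then w (- k) else 0)"
    by (simp only: delta)
  also have "\<dots> = (if 0 < y \<and> y \<le> int ?m then w k else 0) -
      (if y \<noteq> 0 \<and> int n - y \<le> int ?m then w (- k) else 0)"
    unfolding neg y_def[symmetric] using y(2) by simp
  also have "\<dots> = w k"
  proof -
    consider "y = 0" | "0 < y" "y \<le> int ?m" | "int ?m < y" "int n - y \<le> int ?m" | "2 * y = int n"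
      using y n by linarith
    thus ?thesis
    proof cases
      case 1
      thus ?thesis using odd[of 0] wk by simp
    next
      case 2
      hence "\<not> (int n - y \<le> int ?m)" using n by linarith
      thus ?thesis using 2 by simp
    next
      case 3
      thus ?thesis using odd[of k] y by auto
    next
      case 4
      have "y mod int n = (- y + int n) mod int n" using 4 by (intro arg_cong2[where f = "(mod)"]) simp_all
      hence "w y = w (- y)" by (intro periodic_cong[OF per]) simp
      hence "w y = 0" using odd[of y] by simp
      moreover have "\<not> (y \<le> int ?m)" "\<not> (int n - y \<le> int ?m)" using 4 n by linarith+
      ultimately show ?thesis using wk by simp
    qed
  qed
  finally show ?thesis by simp
qed

text \<open>\<open>circulant n a\<close> as an operator on functions, written as a combination of
  shifts of \<open>g\<close>, so that it visibly commutes with shifts.\<close>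

definition correlate :: "nat \<Rightarrow> (int \<Rightarrow> int) \<Rightarrow> (int \<Rightarrow> int) \<Rightarrow> int \<Rightarrow> int" where
  "correlate n a g i = (\<Sum>k\<in>{0..<int n}. a k * g (i + k))"

lemma correlate_circulant:
  assumes "0 < n" "periodic n a" "periodic n g"
  shows "(\<Sum>j<n. a (int j - i) * g (int j)) = correlate n a g i"
proof -
  have per: "periodic n (\<lambda>k. a (k + (- i)) * g k)"
    by (intro periodic_comp2[where F = "(*)"] periodic_shift assms)
  have "(\<Sum>j<n. a (int j - i) * g (int j)) = (\<Sum>k\<in>{0..<int n}. a (k + (- i)) * g k)"
    by (subst sum_int_lessThan[symmetric]) simp
  also have "\<dots> = (\<Sum>k\<in>{0..<int n}. a (k + i + (- i)) * g (k + i))"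
    by (rule sum_shift[OF assms(1) per, symmetric])
  finally show ?thesis by (simp add: correlate_def add.commute)
qed

text \<open>The order matches the diagonal blocks \<open>B\<close>, \<open>B\<close> and
  \<open>\<Lambda>\<close> of the determinant computation. An index below \<open>n\<close> reaches
  the last branch only for even \<open>n\<close>, when \<open>alternating\<close> is
  periodic.\<close>

definition basis_column :: "nat \<Rightarrow> nat \<Rightarrow> int \<Rightarrow> int" where
  "basis_column n c k =
     (let m = (n - 1) div 2 in
      if c < m then odd_basis n c k
      else if c < 2 * m then odd_basis n (c - m) (k + 1) - odd_basis n (c - m) (k - 1)
      else if c = 2 * m then 1 else alternating k)"

lemma basis_column_eq:
  assumes "m = (n - 1) div 2"
  shows "c < m \<Longrightarrow> basis_column n c = odd_basis n c"
    and "c < m \<Longrightarrow> basis_column n (m + c) = (\<lambda>k. odd_basis n c (k + 1) - odd_basis n c (k - 1))"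
    and "basis_column n (2 * m) = (\<lambda>k. 1)"
    and "basis_column n (2 * m + 1) = alternating"
  unfolding basis_column_def Let_def assms[symmetric] by auto

lemma periodic_basis_column:
  assumes "c < n"
  shows "periodic n (basis_column n c)"
proof -
  define m where "m = (n - 1) div 2"
  from assms m_def show ?thesis
  proof (cases rule: column_cases)
    case 1
    thus ?thesis by (simp only: basis_column_eq(1)[OF m_def] periodic_odd_basis)
  next
    case (2 j)
    have "periodic n (\<lambda>k. odd_basis n j (k + 1) - odd_basis n j (k + (- 1)))"
      by (intro periodic_comp2[where F = "(-)"] periodic_shift periodic_odd_basis)
    thus ?thesis using 2 by (simp add: basis_column_eq(2)[OF m_def])
  next
    case 3
    thus ?thesis by (simp only: basis_column_eq(3)[OF m_def] periodic_const)
  next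
    case 4
    show ?thesis unfolding 4(3) basis_column_eq(4)[OF m_def] by (rule periodic_alternating[OF 4(1)])
  qed
qed

text \<open>The second batch of coefficients enters as one odd function taken at
  \<open>k + 1\<close> and \<open>k - 1\<close>. This form serves both the independence of the
  columns and the product with a block matrix.\<close>

lemma sum_basis_columns:
  assumes "0 < n" and m: "m = (n - 1) div 2"
  shows "(\<Sum>c<n. F c * basis_column n c k) =
     (\<Sum>j<m. F j * odd_basis n j k) + (\<Sum>j<m. F (m + j) * odd_basis n j (k + 1))
     - (\<Sum>j<m. F (m + j) * odd_basis n j (k - 1))
     + F (2 * m) + (if even n then F (n - 1) else 0) * alternating k"
proof -
  have main: "(\<Sum>c<m + m. F c * basis_column n c k) =
    (\<Sum>j<m. F j * odd_basis n j k) + (\<Sum>j<m. F (m + j) * odd_basis n j (k + 1))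
     - (\<Sum>j<m. F (m + j) * odd_basis n j (k - 1))"
    unfolding sum_lessThan_add
    by (simp add: basis_column_eq[OF m] right_diff_distrib sum_subtractf)
  from assms(1) show ?thesis
  proof (cases rule: half_pred_cases)
    case 1
    hence n: "{..<n} = insert (2 * m) {..<m + m}"
      unfolding m[symmetric] by (simp add: lessThan_Suc mult_2)
    show ?thesis
      unfolding n using 1(1) main by (simp add: basis_column_eq[OF m])
  next
    case 2
    hence n: "{..<n} = insert (2 * m + 1) (insert (2 * m) {..<m + m})" and last: "n - 1 = 2 * m + 1"
      unfolding m[symmetric] by (auto simp: lessThan_Suc mult_2)
    have "basis_column n (Suc (2 * m)) = alternating"
      using basis_column_eq(4)[OF m] by simp
    thus ?thesis
      unfolding n last using 2(1) main by (simp add: basis_column_eq[OF m])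
  qed
qed

definition basis_matrix :: "nat \<Rightarrow> int mat" where
  "basis_matrix n = mat n n (\<lambda>(i, c). basis_column n c (int i))"

text \<open>A vanishing combination has the form P(k) + Q(k+1) - Q(k-1) + z + z' (-1)^k with odd P
  and Q. Its odd part is P, its mean is z, and for even \<open>n\<close> its mean against the
  alternating function is z'. What remains says that Q has period 2, so Q(i) = Q(-i), and oddness
  forces Q = 0.\<close>

lemma det_basis_matrix:
  assumes n: "0 < n"
  shows "det (basis_matrix n) \<noteq> 0"
proof
  let ?m = "(n - 1) div 2"
  assume "det (basis_matrix n) = 0"
  moreover have "basis_matrix n \<in> carrier_mat n n" by (simp add: basis_matrix_def)
  ultimately obtain v where v: "v \<in> carrier_vec n" "v \<noteq> 0\<^sub>v n" "basis_matrix n *\<^sub>v v = 0\<^sub>v n"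
    using det_0_iff_vec_prod_zero by blast
  define P where "P k = (\<Sum>j<?m. vec_index v j * odd_basis n j k)" for k
  define Q where "Q k = (\<Sum>j<?m. vec_index v (?m + j) * odd_basis n j k)" for k
  define z where "z = vec_index v (2 * ?m)"
  define z' where "z' = (if even n then vec_index v (n - 1) else 0)"
  define g where "g k = (\<Sum>c<n. vec_index v c * basis_column n c k)" for k
  have g: "g k = P k + Q (k + 1) - Q (k - 1) + z + z' * alternating k" for k
    unfolding g_def P_def Q_def z_def z'_def by (rule sum_basis_columns[OF n refl])
  have perg: "periodic n g"
    unfolding g_def by (intro periodic_sum periodic_comp2[where F = "(*)"] periodic_const periodic_basis_column) auto
  have perP: "periodic n P" and perQ: "periodic n Q"
    unfolding P_def Q_def by (intro periodic_sum periodic_comp2[where F = "(*)"] periodic_const periodic_odd_basis)+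
  have oddP: "P (- k) = - P k" and oddQ: "Q (- k) = - Q k" for k
    unfolding P_def Q_def odd_basis_minus by (simp_all add: sum_negf)
  have g0: "g k = 0" for k
  proof -
    define i where "i = nat (k mod int n)"
    have i: "i < n" "int i = k mod int n" using n by (auto simp: i_def nat_less_iff)
    have "0 = vec_index (basis_matrix n *\<^sub>v v) i" using v(3) i(1) by simp
    also have "\<dots> = g (int i)"
      using i(1) v(1) by (simp add: basis_matrix_def scalar_prod_def g_def atLeast0LessThan mult.commute)
    also have "\<dots> = g k" using perg by (simp add: i(2) periodic_def)
    finally show ?thesis by simp
  qed
  have P0: "P k = 0" for k
  proof -
    have "Q (- k + 1) = - Q (k - 1)" "Q (- k - 1) = - Q (k + 1)"
      using oddQ[of "k - 1"] oddQ[of "k + 1"] by simp_all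
    thus ?thesis using g[of k] g[of "- k"] g0 oddP[of k] alternating_minus[of k] by simp
  qed
  have shiftQ: "(\<Sum>k\<in>{0..<int n}. Q (k + 1)) = (\<Sum>k\<in>{0..<int n}. Q k)"
      "(\<Sum>k\<in>{0..<int n}. Q (k - 1)) = (\<Sum>k\<in>{0..<int n}. Q k)"
    using sum_shift[OF n perQ, of 1] sum_shift[OF n perQ, of "- 1"] by simp_all
  \<comment> \<open>For even \<open>n\<close> a shift by one reverses the sign of the sum; for odd
    \<open>n\<close> there is no alternating column and \<open>z'\<close> is 0 by
    definition.\<close>
  have z'alt: "z' * (\<Sum>k\<in>{0..<int n}. alternating k) = 0"
  proof (cases "even n")
    case True
    have "(\<Sum>k\<in>{0..<int n}. alternating (k + 1)) = (\<Sum>k\<in>{0..<int n}. alternating k)"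
      by (rule sum_shift[OF n periodic_alternating[OF True]])
    moreover have "alternating (k + 1) = - alternating k" for k by (simp add: alternating_def)
    ultimately show ?thesis by (simp add: sum_negf)
  qed (simp add: z'_def)
  have "0 = (\<Sum>k\<in>{0..<int n}. g k)" by (simp add: g0)
  also have "\<dots> = int n * z"
    using shiftQ z'alt by (simp add: g P0 sum.distrib sum_subtractf sum_distrib_left)
  finally have z0: "z = 0" using n by simp
  have z'0: "z' = 0"
  proof (cases "even n")
    case True
    have perAQ: "periodic n (\<lambda>k. alternating k * Q k)"
      by (rule periodic_comp2[where F = "(*)"]) (use periodic_alternating True perQ in auto)
    have alt: "alternating (k + 1) = - alternating k" "alternating (k - 1) = - alternating k" for k
      by (simp_all add: alternating_def)
    have "(\<Sum>k\<in>{0..<int n}. alternating k * Q (k + 1)) = (\<Sum>k\<in>{0..<int n}. alternating k * Q (k - 1))"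
      using sum_shift[OF n perAQ, of 1] sum_shift[OF n perAQ, of "- 1"] by (simp add: alt sum_negf)
    moreover have "0 = (\<Sum>k\<in>{0..<int n}. alternating k * g k)" by (simp add: g0)
    moreover have "alternating k * (z' * alternating k) = z'" for k by (simp add: alternating_def)
    ultimately have "0 = int n * z'"
      by (simp add: g P0 z0 sum.distrib sum_subtractf ring_distribs)
    thus ?thesis using n by simp
  qed (simp add: z'_def)
  have step: "Q (k + 2) = Q k" for k
    using g[of "k + 1"] g0 by (simp add: P0 z0 z'0 add.commute)
  have steps: "Q (k + 2 * int i) = Q k" for k i
  proof (induction i)
    case (Suc i)
    have "k + 2 * int (Suc i) = (k + 2 * int i) + 2" by simp
    thus ?case using Suc step[of "k + 2 * int i"] by (simp only:)
  qed simp
  have "Q (int i) = Q (- int i)" for i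
    using steps[of "- int i" i] by simp
  hence Q0: "Q (int i) = 0" for i using oddQ[of "int i"] by simp
  have coeff: "(\<Sum>j<?m. c j * odd_basis n j (int (Suc i))) = c i" if "i < ?m" for c :: "nat \<Rightarrow> int" and i
  proof -
    have "(\<Sum>j<?m. c j * odd_basis n j (int (Suc i))) = (\<Sum>j<?m. if j = i then c i else 0)"
      by (rule sum.cong) (use that in \<open>auto simp: odd_basis_nth simp del: of_nat_Suc\<close>)
    thus ?thesis using that by simp
  qed
  have "vec_index v c = 0" if "c < n" for c
  proof -
    consider "c < ?m" | j where "j < ?m" "c = ?m + j" | "c = 2 * ?m" | "even n" "c = n - 1"
      by (rule column_cases[OF \<open>c < n\<close> refl])
    thus ?thesis
    proof cases
      case 1
      thus ?thesis using coeff[of c "\<lambda>j. vec_index v j"] P0[of "int (Suc c)"] by (simp add: P_def)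
    next
      case (2 j)
      thus ?thesis using coeff[of j "\<lambda>j. vec_index v (?m + j)"] Q0[of "Suc j"] by (simp add: Q_def)
    qed (use z0 z'0 in \<open>simp_all add: z_def z'_def\<close>)
  qed
  hence "v = 0\<^sub>v n" using v(1) by (intro eq_vecI) auto
  thus False using v(2) by contradiction
qed

lemma correlate_alternating: "correlate n a alternating i = (\<Sum>k\<in>{0..<int n}. alternating k * a k) * alternating i"
  unfolding correlate_def sum_distrib_right by (rule sum.cong) (auto simp: alternating_add)

text \<open>On the columns of \<open>basis_matrix n\<close> the matrix acts as the block diagonal
  \<open>D\<close>. Taking determinants and cancelling that of the base change leaves an identity of
  integers with \<open>c = det B\<close>.\<close>

theorem det_symmetric_circulant:
  assumes n: "0 < n" and per: "periodic n a" and even: "\<And>k. a (- k) = a k"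
  shows "\<exists>c. det (circulant n a) =
     (\<Sum>k\<in>{0..<int n}. a k) * (if even n then \<Sum>k\<in>{0..<int n}. alternating k * a k else 1) * c\<^sup>2"
proof -
  define m where "m = (n - 1) div 2"
  define r where "r = n - 2 * m"
  have n_eq: "n = m + m + r" and r: "r = (if even n then 2 else 1)"
    using n unfolding m_def r_def by (cases rule: half_pred_cases; simp)+
  define ev\<^sub>1 where "ev\<^sub>1 = (\<Sum>k\<in>{0..<int n}. a k)"
  define ev\<^sub>2 where "ev\<^sub>2 = (\<Sum>k\<in>{0..<int n}. alternating k * a k)"
  \<comment> \<open>Column \<open>j\<close> lists the values at 1, ..., m of the image of the j-th
    odd function; by \<open>odd_expansion\<close> these are its coordinates.\<close>
  define B where "B = mat m m (\<lambda>(i, j). correlate n a (odd_basis n j) (int (Suc i)))"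
  define \<Lambda> where "\<Lambda> = mat r r (\<lambda>(i, j). if i = j then if i = 0 then ev\<^sub>1 else ev\<^sub>2 else 0)"
  define BB where "BB = four_block_mat B (0\<^sub>m m m) (0\<^sub>m m m) B"
  define D where "D = four_block_mat BB (0\<^sub>m (m + m) r) (0\<^sub>m r (m + m)) \<Lambda>"
  let ?U = "basis_matrix n"
  have carr: "B \<in> carrier_mat m m" "\<Lambda> \<in> carrier_mat r r" "BB \<in> carrier_mat (m + m) (m + m)"
      "D \<in> carrier_mat n n" "?U \<in> carrier_mat n n"
    by (auto simp: B_def \<Lambda>_def BB_def D_def n_eq basis_matrix_def)
  have expand: "correlate n a (odd_basis n j) k = (\<Sum>i<m. B $$ (i, j) * odd_basis n i k)" if "j < m" for j k
  proof -
    let ?w = "correlate n a (odd_basis n j)"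
    have perw: "periodic n ?w"
      unfolding correlate_def
      by (intro periodic_sum periodic_comp2[where F = "(*)"] periodic_const periodic_shift periodic_odd_basis)
    \<comment> \<open>Reflecting the summation index uses \<open>a (- k) = a k\<close>: a symmetric
      circulant preserves oddness.\<close>
    have oddw: "?w (- x) = - ?w x" for x
    proof -
      have p: "periodic n (\<lambda>k. a k * odd_basis n j (k + (- x)))"
        by (intro periodic_comp2[where F = "(*)"] periodic_shift periodic_odd_basis per)
      have "?w (- x) = (\<Sum>k\<in>{0..<int n}. a k * odd_basis n j (k + (- x)))"
        by (simp add: correlate_def)
      also have "\<dots> = (\<Sum>k\<in>{0..<int n}. a (0 - k) * odd_basis n j (0 - k + (- x)))"
        by (rule sum_reflect[OF n p, symmetric])
      also have "\<dots> = (\<Sum>k\<in>{0..<int n}. - (a k * odd_basis n j (x + k)))"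
        using odd_basis_minus[of n j "x + k" for k] by (simp add: even algebra_simps)
      finally show ?thesis by (simp add: correlate_def sum_negf)
    qed
    show ?thesis
      using odd_expansion[OF n perw oddw, of k] that unfolding m_def[symmetric]
      by (simp add: B_def)
  qed
  \<comment> \<open>Because of this commutation the second batch of columns transforms by the same
    \<open>B\<close> as the first.\<close>
  have diff: "correlate n a (\<lambda>x. g (x + 1) - g (x - 1)) k = correlate n a g (k + 1) - correlate n a g (k - 1)" for g k
    by (simp add: correlate_def ring_distribs sum_subtractf algebra_simps)
  have D_entry: "D $$ (i, c) =
      (if i < m + m \<and> c < m + m then BB $$ (i, c)
       else if i < m + m \<or> c < m + m then 0 else \<Lambda> $$ (i - (m + m), c - (m + m)))"
    if "i < m + m + r" "c < m + m + r" for i c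
    using that carr unfolding D_def by auto
  have BB_entry: "BB $$ (i, c) =
      (if i < m \<and> c < m then B $$ (i, c) else if i < m \<or> c < m then 0 else B $$ (i - m, c - m))"
    if "i < m + m" "c < m + m" for i c
    using that carr unfolding BB_def by auto
  have \<Lambda>_entry: "\<Lambda> $$ (i, c) = (if i = c then if i = 0 then ev\<^sub>1 else ev\<^sub>2 else 0)" if "i < r" "c < r" for i c
    using that by (simp add: \<Lambda>_def)
  have last: "n - 1 = Suc (2 * m)" "1 < r" if "even n"
  proof -
    have "r = 2" using r that by simp
    thus "n - 1 = Suc (2 * m)" "1 < r" unfolding n_eq by simp_all
  qed
  have rpos: "0 < r" using r by simp
  note entries = D_entry BB_entry \<Lambda>_entry
  have Dcol: "correlate n a (basis_column n c) k = (\<Sum>c'<n. D $$ (c', c) * basis_column n c' k)" if c: "c < n" for c k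
  proof -
    consider (1) "c < m" | (2) j where "j < m" "c = m + j" | (3) "c = 2 * m" | (4) "even n" "c = n - 1" "c = 2 * m + 1"
      by (rule column_cases[OF \<open>c < n\<close> m_def])
    thus ?thesis
    proof cases
      case 1
      have "correlate n a (basis_column n c) k = (\<Sum>i<m. B $$ (i, c) * odd_basis n i k)"
        using 1 by (simp add: basis_column_eq[OF m_def] expand)
      thus ?thesis using 1 rpos last
        unfolding sum_basis_columns[OF n m_def]
        by (cases "even n") (simp_all add: entries del: One_nat_def)
    next
      case (2 j)
      have "correlate n a (basis_column n c) k =
          (\<Sum>i<m. B $$ (i, j) * odd_basis n i (k + 1)) - (\<Sum>i<m. B $$ (i, j) * odd_basis n i (k - 1))"
        using 2 by (simp add: basis_column_eq[OF m_def] diff expand)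
      thus ?thesis using 2 rpos last
        unfolding sum_basis_columns[OF n m_def]
        by (cases "even n") (simp_all add: entries del: One_nat_def)
    next
      case 3
      have "correlate n a (basis_column n c) k = ev\<^sub>1"
        using 3 by (simp add: basis_column_eq[OF m_def] correlate_def ev\<^sub>1_def)
      thus ?thesis using 3 rpos last
        unfolding sum_basis_columns[OF n m_def]
        by (cases "even n") (simp_all add: entries del: One_nat_def)
    next
      case 4
      have "correlate n a (basis_column n c) k = ev\<^sub>2 * alternating k"
        unfolding 4(3) basis_column_eq[OF m_def] by (simp add: correlate_alternating ev\<^sub>2_def)
      thus ?thesis using 4(1,3) rpos last
        unfolding sum_basis_columns[OF n m_def]
        by (simp add: entries del: One_nat_def)
    qed
  qed
  have "circulant n a * ?U = ?U * D"
  proof (rule eq_matI)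
    fix i c assume "i < dim_row (?U * D)" "c < dim_col (?U * D)"
    hence ic: "i < n" "c < n" using carr by auto
    have "(circulant n a * ?U) $$ (i, c) = (\<Sum>j<n. a (int j - int i) * basis_column n c (int j))"
      using ic by (simp add: circulant_def basis_matrix_def scalar_prod_def atLeast0LessThan)
    also have "\<dots> = correlate n a (basis_column n c) (int i)"
      by (rule correlate_circulant[OF n per periodic_basis_column[OF ic(2)]])
    also have "\<dots> = (?U * D) $$ (i, c)"
      using ic carr by (simp add: Dcol basis_matrix_def scalar_prod_def atLeast0LessThan mult.commute)
    finally show "(circulant n a * ?U) $$ (i, c) = (?U * D) $$ (i, c)" .
  qed (use carr in \<open>auto simp: circulant_def\<close>)
  hence "det (circulant n a) * det ?U = det ?U * det D"
    using carr by (metis circulant_carrier det_mult)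
  hence "det (circulant n a) = det D"
    using det_basis_matrix[OF n] by simp
  also have "\<dots> = det BB * det \<Lambda>"
    unfolding D_def by (rule det_four_block_mat_upper_right_zero) (use carr in auto)
  also have "det BB = (det B)\<^sup>2"
    unfolding BB_def using carr
    by (subst det_four_block_mat_upper_right_zero[of _ m _ m]) (auto simp: power2_eq_square)
  also have "det \<Lambda> = ev\<^sub>1 * (if even n then ev\<^sub>2 else 1)"
  proof -
    have "det \<Lambda> = prod_list (diag_mat \<Lambda>)"
      by (rule det_upper_triangular[of _ r]) (auto simp: \<Lambda>_def)
    also have "\<dots> = (\<Prod>i<r. if i = 0 then ev\<^sub>1 else ev\<^sub>2)"
      by (simp add: prod_list_diag_prod \<Lambda>_def atLeast0LessThan)
    finally show ?thesis using r by (simp add: numeral_2_eq_2)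
  qed
  finally show ?thesis
    by (intro exI[of _ "det B"]) (simp add: ev\<^sub>1_def ev\<^sub>2_def)
qed

section \<open>Bicirculant graphs\<close>

lemma sum_edge_form:
  assumes G: "simple_ugraph G"
  shows "(\<Sum>e\<in>uedges G. edge_form e x y) =
     (if x = y then int (card {z. {x, z} \<in> uedges G}) else - of_bool ({x, y} \<in> uedges G))"
proof -
  have E: "e \<subseteq> uverts G" "card e = 2" if "e \<in> uedges G" for e
    using G that by (auto simp: simple_ugraph_def)
  have "finite (uverts G)" using G by (simp add: simple_ugraph_def)
  hence fin: "finite (uedges G)"
    using E(1) by (intro finite_subset[of "uedges G" "Pow (uverts G)"]) auto
  show ?thesis
  proof (cases "x = y")
    case True
    have "bij_betw (\<lambda>z. {x, z}) {z. {x, z} \<in> uedges G} {e \<in> uedges G. x \<in> e}"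
    proof (intro bij_betw_imageI inj_onI)
      show "(\<lambda>z. {x, z}) ` {z. {x, z} \<in> uedges G} = {e \<in> uedges G. x \<in> e}"
      proof (intro equalityI subsetI)
        fix e assume e: "e \<in> {e \<in> uedges G. x \<in> e}"
        then obtain z where "e = {x, z}" using E(2)[of e] by (auto simp: card_2_iff)
        thus "e \<in> (\<lambda>z. {x, z}) ` {z. {x, z} \<in> uedges G}" using e by auto
      qed auto
    qed (auto simp: doubleton_eq_iff)
    hence card: "card {z. {x, z} \<in> uedges G} = card {e \<in> uedges G. x \<in> e}"
      by (rule bij_betw_same_card)
    have "(\<Sum>e\<in>uedges G. edge_form e x y) = (\<Sum>e\<in>uedges G. of_bool (x \<in> e))"
      by (rule sum.cong) (auto simp: edge_form_def E True)
    also have "\<dots> = int (card {e \<in> uedges G. x \<in> e})"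
      using fin by (simp add: Int_def)
    finally show ?thesis using card True by simp
  next
    case False
    have "(\<Sum>e\<in>uedges G. edge_form e x y) = (\<Sum>e\<in>uedges G. if e = {x, y} then - 1 else 0)"
    proof (rule sum.cong)
      fix e assume "e \<in> uedges G"
      then obtain p q where "e = {p, q}" "p \<noteq> q" using E(2)[of e] by (auto simp: card_2_iff)
      thus "edge_form e x y = (if e = {x, y} then - 1 else 0)"
        using False by (auto simp: edge_form_pair doubleton_eq_iff)
    qed simp
    thus ?thesis using False fin by simp
  qed
qed

section \<open>Symbols of circulant matrices, their sums and their convolution\<close>

definition residue_indicator :: "nat \<Rightarrow> int set \<Rightarrow> int \<Rightarrow> int" where
  "residue_indicator n R k = of_bool (k mod int n \<in> R)"

lemma periodic_residue_indicator: "periodic n (residue_indicator n R)"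
  by (simp add: periodic_def residue_indicator_def)

lemma sum_residue_indicator:
  assumes "R \<subseteq> {0..<int n}"
  shows "(\<Sum>k\<in>{0..<int n}. \<chi> k * residue_indicator n R k) = (\<Sum>k\<in>R. \<chi> k)"
proof -
  have "(\<Sum>k\<in>{0..<int n}. \<chi> k * residue_indicator n R k) = (\<Sum>k\<in>{0..<int n}. if k \<in> R then \<chi> k else 0)"
    by (rule sum.cong) (auto simp: residue_indicator_def)
  also have "\<dots> = (\<Sum>k\<in>{k \<in> {0..<int n}. k \<in> R}. \<chi> k)"
    by (rule sum.inter_filter[symmetric]) simp
  also have "{k \<in> {0..<int n}. k \<in> R} = R" using assms by auto
  finally show ?thesis .
qed

lemma card_translate:
  assumes "0 < n" "R \<subseteq> {0..<int n}"
  shows "card {k \<in> {0..<int n}. (k - c) mod int n \<in> R} = card R"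
    and "card {k \<in> {0..<int n}. (c - k) mod int n \<in> R} = card R"
proof -
  let ?g = "residue_indicator n R"
  have count: "int (card {k \<in> {0..<int n}. F k mod int n \<in> R}) = (\<Sum>k\<in>{0..<int n}. ?g (F k))" for F
    by (simp add: residue_indicator_def Int_def)
  have total: "(\<Sum>k\<in>{0..<int n}. ?g k) = int (card R)"
    using sum_residue_indicator[OF assms(2), of "\<lambda>_. 1"] by simp
  have "int (card {k \<in> {0..<int n}. (k - c) mod int n \<in> R}) = int (card R)"
    unfolding count using sum_shift[OF assms(1) periodic_residue_indicator, of R "- c"] total by simp
  thus "card {k \<in> {0..<int n}. (k - c) mod int n \<in> R} = card R" by simp
  have "int (card {k \<in> {0..<int n}. (c - k) mod int n \<in> R}) = int (card R)"
    unfolding count using sum_reflect[OF assms(1) periodic_residue_indicator, of R c] total by simp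
  thus "card {k \<in> {0..<int n}. (c - k) mod int n \<in> R} = card R" by simp
qed

definition convolve :: "nat \<Rightarrow> (int \<Rightarrow> int) \<Rightarrow> (int \<Rightarrow> int) \<Rightarrow> int \<Rightarrow> int" where
  "convolve n a b d = (\<Sum>k\<in>{0..<int n}. a k * b (d - k))"

context
  fixes n :: nat and a b :: "int \<Rightarrow> int"
  assumes n: "0 < n" and per: "periodic n a" "periodic n b"
begin

lemma circulant_mult: "circulant n a * circulant n b = circulant n (convolve n a b)"
proof (rule eq_matI)
  fix i j assume "i < dim_row (circulant n (convolve n a b))" "j < dim_col (circulant n (convolve n a b))"
  hence ij: "i < n" "j < n" by (auto simp: circulant_def)
  have per': "periodic n (\<lambda>k. b (int j - k))" by (rule periodic_reflect[OF per(2)])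
  have "(circulant n a * circulant n b) $$ (i, j) = (\<Sum>l<n. a (int l - int i) * b (int j - int l))"
    using ij by (simp add: circulant_def scalar_prod_def atLeast0LessThan)
  also have "\<dots> = correlate n a (\<lambda>k. b (int j - k)) (int i)"
    by (rule correlate_circulant[OF n per(1) per'])
  also have "\<dots> = circulant n (convolve n a b) $$ (i, j)"
    using ij by (simp add: circulant_def convolve_def correlate_def diff_diff_eq)
  finally show "(circulant n a * circulant n b) $$ (i, j) = circulant n (convolve n a b) $$ (i, j)" .
qed (auto simp: circulant_def)

lemma convolve_commute: "convolve n a b = convolve n b a"
proof
  fix d
  have "periodic n (\<lambda>k. a k * b (d - k))"
    by (intro periodic_comp2[where F = "(*)"] periodic_reflect per)
  from sum_reflect[OF n this, of d] show "convolve n a b d = convolve n b a d"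
    by (simp add: convolve_def mult.commute)
qed

lemma convolve_minus: "convolve n a b (- d) = convolve n (\<lambda>k. a (- k)) (\<lambda>k. b (- k)) d"
proof -
  have "periodic n (\<lambda>k. a k * b (- d - k))"
    by (intro periodic_comp2[where F = "(*)"] periodic_reflect per)
  from sum_reflect[OF n this, of 0] show ?thesis
    by (simp add: convolve_def)
qed

lemma periodic_convolve: "periodic n (convolve n a b)"
proof -
  have "periodic n (\<lambda>d. b (d + (- k)))" for k by (rule periodic_shift[OF per(2)])
  hence "periodic n (\<lambda>d. \<Sum>k\<in>{0..<int n}. a k * b (d + (- k)))"
    by (intro periodic_sum periodic_comp2[where F = "(*)"] periodic_const)
  thus ?thesis by (simp add: convolve_def[abs_def])
qed

text \<open>A character turns convolution into multiplication. For the characters 1 and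
  \<open>alternating\<close> this gives the exceptional eigenvalues of a product of circulants
  without diagonalising.\<close>

lemma sum_character_convolve:
  assumes "periodic n \<chi>" and mult: "\<And>x y. \<chi> (x + y) = \<chi> x * \<chi> y"
  shows "(\<Sum>d\<in>{0..<int n}. \<chi> d * convolve n a b d) =
    (\<Sum>k\<in>{0..<int n}. \<chi> k * a k) * (\<Sum>k\<in>{0..<int n}. \<chi> k * b k)"
proof -
  have per': "periodic n (\<lambda>k. \<chi> k * b k)"
    by (intro periodic_comp2[where F = "(*)"] assms(1) per)
  have "(\<Sum>d\<in>{0..<int n}. \<chi> d * convolve n a b d) =
      (\<Sum>k\<in>{0..<int n}. \<Sum>d\<in>{0..<int n}. \<chi> d * (a k * b (d - k)))"
    unfolding convolve_def sum_distrib_left by (rule sum.swap)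
  also have "\<dots> = (\<Sum>k\<in>{0..<int n}. \<chi> k * a k * (\<Sum>d\<in>{0..<int n}. \<chi> (d + (- k)) * b (d + (- k))))"
  proof (intro sum.cong refl)
    fix k
    have "\<chi> d * (a k * b (d - k)) = \<chi> k * a k * (\<chi> (d + (- k)) * b (d + (- k)))" for d
      using mult[of k "d + (- k)"] by simp
    thus "(\<Sum>d\<in>{0..<int n}. \<chi> d * (a k * b (d - k))) =
        \<chi> k * a k * (\<Sum>d\<in>{0..<int n}. \<chi> (d + (- k)) * b (d + (- k)))"
      unfolding sum_distrib_left by (intro sum.cong refl)
  qed
  also have "\<dots> = (\<Sum>k\<in>{0..<int n}. \<chi> k * a k) * (\<Sum>k\<in>{0..<int n}. \<chi> k * b k)"
    unfolding sum_shift[OF n per'] by (simp add: sum_distrib_right)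
  finally show ?thesis .
qed

end

section \<open>The forest count of a bicirculant graph\<close>

locale bicirculant_data =
  fixes n :: nat and R T S :: "int set"
  assumes n: "0 < n"
    and R: "R \<subseteq> {1..<int n}" "\<And>x. x \<in> R \<Longrightarrow> (- x) mod int n \<in> R"
    and T: "T \<subseteq> {1..<int n}" "\<And>x. x \<in> T \<Longrightarrow> (- x) mod int n \<in> T"
    and S: "S \<subseteq> {0..<int n}"
begin

abbreviation "Z \<equiv> {0..<int n}"
abbreviation "G \<equiv> bicirculant n R T S"

text \<open>First row of a diagonal block of \<open>I + L\<close>: every vertex of that side has
  degree \<open>card X + card S\<close>.\<close>

definition diag_symbol :: "int set \<Rightarrow> int \<Rightarrow> int" where
  "diag_symbol X k = (1 + int (card X) + int (card S)) * of_bool (k mod int n = 0) - residue_indicator n X k"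

definition cross_symbol :: "int \<Rightarrow> int" where
  "cross_symbol k = - residue_indicator n S k"

lemma swap_mod:
  assumes "\<And>x. x \<in> X \<Longrightarrow> (- x) mod int n \<in> X"
  shows "(g - h) mod int n \<in> X \<longleftrightarrow> (h - g) mod int n \<in> X"
  using assms[of "(g - h) mod int n"] assms[of "(h - g) mod int n"] by (auto simp: mod_minus_eq)

lemma edges:
  "{Inl h, Inl g} \<in> uedges G \<longleftrightarrow> h \<in> Z \<and> g \<in> Z \<and> (g - h) mod int n \<in> R"
  "{Inr h, Inr g} \<in> uedges G \<longleftrightarrow> h \<in> Z \<and> g \<in> Z \<and> (g - h) mod int n \<in> T"
  "{Inl h, Inr g} \<in> uedges G \<longleftrightarrow> h \<in> Z \<and> g \<in> Z \<and> (g - h) mod int n \<in> S"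
  "{Inr g, Inl h} \<in> uedges G \<longleftrightarrow> h \<in> Z \<and> g \<in> Z \<and> (g - h) mod int n \<in> S"
  using swap_mod[OF R(2), of g h] swap_mod[OF T(2), of g h]
  by (auto simp: bicirculant_def doubleton_eq_iff)

lemma degree:
  assumes "h \<in> Z"
  shows "card {z. {Inl h, z} \<in> uedges G} = card R + card S"
    and "card {z. {Inr h, z} \<in> uedges G} = card T + card S"
proof -
  have sub: "R \<subseteq> Z" "T \<subseteq> Z" using R(1) T(1) by auto
  have fin: "finite {k \<in> Z. P k}" for P
    by (rule finite_subset[of _ Z]) auto
  have "{z. {Inl h, z} \<in> uedges G} = {g \<in> Z. (g - h) mod int n \<in> R} <+> {g \<in> Z. (g - h) mod int n \<in> S}"
  proof (rule Set.set_eqI)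
    fix z show "z \<in> {z. {Inl h, z} \<in> uedges G} \<longleftrightarrow>
        z \<in> {g \<in> Z. (g - h) mod int n \<in> R} <+> {g \<in> Z. (g - h) mod int n \<in> S}"
      using assms by (cases z) (auto simp: edges)
  qed
  thus "card {z. {Inl h, z} \<in> uedges G} = card R + card S"
    by (simp only: card_Plus fin card_translate[OF n sub(1)] card_translate[OF n S])
  have "{z. {Inr h, z} \<in> uedges G} = {g \<in> Z. (h - g) mod int n \<in> S} <+> {g \<in> Z. (g - h) mod int n \<in> T}"
  proof (rule Set.set_eqI)
    fix z show "z \<in> {z. {Inr h, z} \<in> uedges G} \<longleftrightarrow>
        z \<in> {g \<in> Z. (h - g) mod int n \<in> S} <+> {g \<in> Z. (g - h) mod int n \<in> T}"
      using assms by (cases z) (auto simp: edges)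
  qed
  thus "card {z. {Inr h, z} \<in> uedges G} = card T + card S"
    by (simp only: card_Plus fin card_translate[OF n sub(2)] card_translate[OF n S] add.commute)
qed

text \<open>All \<open>Inl\<close> vertices precede all \<open>Inr\<close> vertices, which makes
  \<open>I + L\<close> a 2 by 2 block matrix of circulants.\<close>

definition vertex :: "nat \<Rightarrow> int + int" where
  "vertex i = (if i < n then Inl (int i) else Inr (int (i - n)))"

sublocale finite_enum "Z <+> Z" "n + n" vertex
proof
  show "bij_betw vertex {..<n + n} (Z <+> Z)"
    by (rule bij_betw_byWitness[where f' = "case_sum nat (\<lambda>k. n + nat k)"])
      (auto simp: vertex_def split: if_splits)
qed

lemma dvd_diff_iff_eq:
  "i < n \<and> j < n \<or> n \<le> i \<and> i < n + n \<and> n \<le> j \<and> j < n + n \<Longrightarrow> int n dvd int j - int i \<longleftrightarrow> i = j"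
  using dvd_imp_le_int[of "int j - int i" "int n"]
  by (cases "i = j") (auto simp: abs_if split: if_splits)

lemma simple: "simple_ugraph G"
  by (rule simple_bicirculant) (use R(1) T(1) in auto)

text \<open>The lower left block is the transpose of the upper right one, hence the reflected
  \<open>cross_symbol\<close>. Circulants commute, as the block formula det(AD - BC) requires of C
  and D.\<close>

lemma num_forests_det:
  "int (num_rooted_spanning_forests G) =
     det (circulant n (diag_symbol R) * circulant n (diag_symbol T)
          - circulant n cross_symbol * circulant n (\<lambda>k. cross_symbol (- k)))"
proof -
  let ?M = "\<lambda>x y. of_bool (x = y) + (\<Sum>e\<in>uedges G. edge_form e x y)"
  let ?A = "circulant n (diag_symbol R)" and ?D = "circulant n (diag_symbol T)"
  let ?B = "circulant n cross_symbol" and ?C = "circulant n (\<lambda>k. cross_symbol (- k))"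
  have "0 \<notin> R" "0 \<notin> T" using R(1) T(1) by auto
  hence entries: "?M (vertex i) (vertex j) = four_block_mat ?A ?B ?C ?D $$ (i, j)"
    if "i < n + n" "j < n + n" for i j
    using that n unfolding sum_edge_form[OF simple] circulant_def
    by (auto simp: vertex_def edges degree diag_symbol_def cross_symbol_def residue_indicator_def
        mod_eq_0_iff_dvd dvd_diff_iff_eq not_less)
  have "mat (n + n) (n + n) (\<lambda>(i, j). ?M (vertex i) (vertex j)) = four_block_mat ?A ?B ?C ?D"
    by (rule eq_matI) (use entries in \<open>auto simp: circulant_def\<close>)
  hence "int (num_rooted_spanning_forests G) = det (four_block_mat ?A ?B ?C ?D)"
    using matrix_forest[OF simple] by (simp add: det_on_def bicirculant_def)
  also have "\<dots> = det (?A * ?D - ?B * ?C)"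
  proof (rule det_four_block_mat[where n = n])
    have "periodic n (diag_symbol T)" "periodic n (\<lambda>k. cross_symbol (- k))"
      by (auto simp: periodic_def diag_symbol_def cross_symbol_def residue_indicator_def mod_minus_eq)
    thus "?C * ?D = ?D * ?C"
      by (simp add: circulant_mult[OF n] convolve_commute[OF n])
  qed auto
  finally show ?thesis .
qed

lemma num_forests:
  "\<exists>c. int (num_rooted_spanning_forests G) =
     (2 * int (card S) + 1) *
     (if even n then
        (1 + int (card R) + int (card S) - (\<Sum>x\<in>R. alternating x)) *
        (1 + int (card T) + int (card S) - (\<Sum>x\<in>T. alternating x)) - (\<Sum>x\<in>S. alternating x)\<^sup>2
      else 1) * c\<^sup>2"
proof -
  let ?a = "diag_symbol R" and ?d = "diag_symbol T" and ?b = cross_symbol and ?c = "\<lambda>k. cross_symbol (- k)"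
  define \<mu> where "\<mu> k = convolve n ?a ?d k - convolve n ?b ?c k" for k
  have per: "periodic n ?a" "periodic n ?d" "periodic n ?b" "periodic n ?c"
    by (auto simp: periodic_def diag_symbol_def cross_symbol_def residue_indicator_def mod_minus_eq)
  have even: "diag_symbol X (- k) = diag_symbol X k" if "\<And>x. x \<in> X \<Longrightarrow> (- x) mod int n \<in> X" for X k
    using swap_mod[OF that, of 0 k] by (simp add: diag_symbol_def residue_indicator_def mod_eq_0_iff_dvd)
  \<comment> \<open>Reflection fixes the two diagonal symbols and exchanges the two cross symbols;
    commutativity of convolution undoes the exchange.\<close>
  have \<mu>_minus: "\<mu> (- k) = \<mu> k" for k
    unfolding \<mu>_def convolve_minus[OF n per(1,2)] convolve_minus[OF n per(3,4)]
    using convolve_commute[OF n per(3,4)] by (simp add: even[OF R(2)] even[OF T(2)])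
  have per\<mu>: "periodic n \<mu>"
    unfolding \<mu>_def by (intro periodic_comp2[where F = "(-)"] periodic_convolve n per)
  have "circulant n ?a * circulant n ?d - circulant n ?b * circulant n ?c = circulant n \<mu>"
    unfolding circulant_mult[OF n per(1,2)] circulant_mult[OF n per(3,4)]
    by (rule eq_matI) (auto simp: circulant_def \<mu>_def)
  hence det: "int (num_rooted_spanning_forests G) = det (circulant n \<mu>)"
    by (simp add: num_forests_det)
  \<comment> \<open>Done for both real characters at once. Since
    \<open>\<chi> (- x) = \<chi> x\<close>, the two cross symbols have the same sum, whence the
    square.\<close>
  have char: "(\<Sum>k\<in>Z. \<chi> k * \<mu> k) =
      (1 + int (card R) + int (card S) - (\<Sum>x\<in>R. \<chi> x)) *
      (1 + int (card T) + int (card S) - (\<Sum>x\<in>T. \<chi> x)) - (\<Sum>x\<in>S. \<chi> x)\<^sup>2"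
    if \<chi>: "periodic n \<chi>" "\<And>x y. \<chi> (x + y) = \<chi> x * \<chi> y" "\<And>x. \<chi> (- x) = \<chi> x" "\<chi> 0 = 1" for \<chi>
  proof -
    have diag: "(\<Sum>k\<in>Z. \<chi> k * diag_symbol X k) = 1 + int (card X) + int (card S) - (\<Sum>x\<in>X. \<chi> x)"
      if "X \<subseteq> {1..<int n}" for X
    proof -
      have "(\<Sum>k\<in>Z. \<chi> k * diag_symbol X k) =
          (\<Sum>k\<in>Z. if k = 0 then 1 + int (card X) + int (card S) else 0) - (\<Sum>k\<in>Z. \<chi> k * residue_indicator n X k)"
        unfolding sum_subtractf[symmetric]
        by (intro sum.cong) (auto simp: diag_symbol_def \<chi>(4) right_diff_distrib)
      also have "(\<Sum>k\<in>Z. \<chi> k * residue_indicator n X k) = (\<Sum>x\<in>X. \<chi> x)"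
        by (rule sum_residue_indicator) (use that in auto)
      finally show ?thesis using n by simp
    qed
    have cross: "(\<Sum>k\<in>Z. \<chi> k * ?b k) = - (\<Sum>x\<in>S. \<chi> x)"
      using sum_residue_indicator[OF S, of \<chi>] by (simp add: cross_symbol_def sum_negf)
    have "periodic n (\<lambda>k. \<chi> k * ?b k)" by (intro periodic_comp2[where F = "(*)"] \<chi>(1) per)
    from sum_reflect[OF n this, of 0] have "(\<Sum>k\<in>Z. \<chi> k * ?c k) = - (\<Sum>x\<in>S. \<chi> x)"
      by (simp add: \<chi>(3) cross)
    thus ?thesis
      unfolding \<mu>_def right_diff_distrib sum_subtractf
        sum_character_convolve[OF n per(1,2) \<chi>(1,2)] sum_character_convolve[OF n per(3,4) \<chi>(1,2)]
      by (simp add: diag R(1) T(1) cross power2_eq_square algebra_simps)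
  qed
  \<comment> \<open>The sums over \<open>R\<close> and \<open>T\<close> cancel against the degrees,
    leaving (1 + s)^2 - s^2 with s = \<open>card S\<close>.\<close>
  have one: "(\<Sum>k\<in>Z. \<mu> k) = 2 * int (card S) + 1"
    using char[of "\<lambda>_. 1"] by (simp add: periodic_const power2_eq_square algebra_simps)
  obtain c where "det (circulant n \<mu>) =
      (\<Sum>k\<in>Z. \<mu> k) * (if even n then \<Sum>k\<in>Z. alternating k * \<mu> k else 1) * c\<^sup>2"
    using det_symmetric_circulant[OF n per\<mu> \<mu>_minus] by blast
  moreover have "(\<Sum>k\<in>Z. alternating k * \<mu> k) =
      (1 + int (card R) + int (card S) - (\<Sum>x\<in>R. alternating x)) *
      (1 + int (card T) + int (card S) - (\<Sum>x\<in>T. alternating x)) - (\<Sum>x\<in>S. alternating x)\<^sup>2"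
    if "even n"
    using periodic_alternating[OF that] alternating_add alternating_minus
    by (rule char) (simp add: alternating_def)
  ultimately show ?thesis
    unfolding det one by (intro exI[of _ c]) simp
qed

end

section \<open>Connection sets given by generators below n/2\<close>

lemma pm_residues:
  assumes A: "A \<subseteq> {1..}" "\<And>x. x \<in> A \<Longrightarrow> 2 * x < int n"
  shows "pm_residues_mod n A = A \<union> (\<lambda>x. int n - x) ` A" "A \<inter> (\<lambda>x. int n - x) ` A = {}"
proof -
  have mod: "x mod int n = x" "(- x) mod int n = int n - x" if "x \<in> A" for x
  proof -
    have "1 \<le> x" "2 * x < int n" using A that by auto
    thus "x mod int n = x" by simp
    thus "(- x) mod int n = int n - x" using \<open>1 \<le> x\<close> by (simp add: zmod_zminus1_eq_if)
  qed
  have "(\<lambda>a. a mod int n) ` A = (\<lambda>a. a) ` A" "(\<lambda>a. (- a) mod int n) ` A = (\<lambda>x. int n - x) ` A"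
    using mod by (auto intro!: image_cong simp del: image_ident)
  thus "pm_residues_mod n A = A \<union> (\<lambda>x. int n - x) ` A"
    by (simp add: pm_residues_mod_def residues_mod_def image_Un image_image)
  show "A \<inter> (\<lambda>x. int n - x) ` A = {}"
  proof (intro equals0I)
    fix x assume "x \<in> A \<inter> (\<lambda>x. int n - x) ` A"
    then obtain y where "x \<in> A" "y \<in> A" "x = int n - y" by blast
    thus False using A(2)[of x] A(2)[of y] by linarith
  qed
qed

lemma sum_alternating: "finite A \<Longrightarrow> (\<Sum>x\<in>A. alternating x) = int (card {x \<in> A. even x}) - int (card {x \<in> A. odd x})"
proof (induction rule: finite_induct)
  case (insert x A)
  have "{y \<in> insert x A. even y} = (if even x then insert x {y \<in> A. even y} else {y \<in> A. even y})"
    "{y \<in> insert x A. odd y} = (if odd x then insert x {y \<in> A. odd y} else {y \<in> A. odd y})" by auto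
  with insert show ?case by (simp add: alternating_def)
qed simp

lemma card_even_odd: "finite A \<Longrightarrow> int (card A) = int (card {x \<in> A. even x}) + int (card {x \<in> A. odd (x :: int)})"
  by (subst of_nat_add[symmetric], subst card_Un_disjoint[symmetric]) (auto intro!: arg_cong[where f = card])

text \<open>The bound \<open>2 * x < int n\<close> separates \<open>A\<close> from its negatives,
  which become \<open>int n - x\<close>; for even \<open>n\<close> these have the parity of
  \<open>x\<close>.\<close>

lemma pm_residues_card:
  assumes "finite A" and A: "A \<subseteq> {1..}" "\<And>x. x \<in> A \<Longrightarrow> 2 * x < int n"
  shows "card (pm_residues_mod n A) = 2 * card A"
    and "even n \<Longrightarrow> (\<Sum>x\<in>pm_residues_mod n A. alternating x) = 2 * (\<Sum>x\<in>A. alternating x)"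
proof -
  have inj: "inj_on (\<lambda>x. int n - x) A" by (auto simp: inj_on_def)
  show "card (pm_residues_mod n A) = 2 * card A"
    using pm_residues[OF A] assms(1) by (simp add: card_Un_disjoint card_image[OF inj])
  assume "even n"
  hence "alternating (int n - x) = alternating x" for x by (auto simp: alternating_def)
  thus "(\<Sum>x\<in>pm_residues_mod n A. alternating x) = 2 * (\<Sum>x\<in>A. alternating x)"
    using pm_residues[OF A] assms(1) by (simp add: sum.union_disjoint sum.reindex[OF inj])
qed

lemma pm_residues_symmetric:
  assumes n: "0 < n" and A: "A \<subseteq> {1..}" "\<And>x. x \<in> A \<Longrightarrow> 2 * x < int n"
  shows "pm_residues_mod n A \<subseteq> {1..<int n}"
    and "x \<in> pm_residues_mod n A \<Longrightarrow> (- x) mod int n \<in> pm_residues_mod n A"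
    and "even n \<Longrightarrow> int n div 2 \<notin> pm_residues_mod n A"
proof -
  have bounds: "1 \<le> x" "2 * x < int n" if "x \<in> A" for x using A that by auto
  have eq: "pm_residues_mod n A = A \<union> (\<lambda>x. int n - x) ` A" by (rule pm_residues(1)[OF A])
  show sub: "pm_residues_mod n A \<subseteq> {1..<int n}"
  proof
    fix y assume "y \<in> pm_residues_mod n A"
    then obtain x where "x \<in> A" "y = x \<or> y = int n - x"
      unfolding eq by blast
    thus "y \<in> {1..<int n}" using bounds[of x] by auto
  qed
  show "(- x) mod int n \<in> pm_residues_mod n A" if "x \<in> pm_residues_mod n A"
  proof -
    have "1 \<le> x" "x < int n" using sub that by auto
    hence "(- x) mod int n = int n - x" by (simp add: zmod_zminus1_eq_if)
    thus ?thesis using that unfolding eq by auto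
  qed
  show "int n div 2 \<notin> pm_residues_mod n A" if "even n"
  proof
    assume "int n div 2 \<in> pm_residues_mod n A"
    then obtain x where x: "x \<in> A" "int n div 2 = x \<or> int n div 2 = int n - x"
      unfolding eq by blast
    have "2 * (int n div 2) = int n" using that by simp
    thus False using x bounds(2)[OF x(1)] by linarith
  qed
qed

text \<open>The Boolean tells whether n/2 is added, so that the four graphs become instances of one
  statement.\<close>

definition antipode :: "nat \<Rightarrow> bool \<Rightarrow> int set" where
  "antipode n b = (if b then {int n div 2} else {})"

text \<open>
  Adding \<open>n div 2\<close> to a connection set changes its degree by \<open>1\<close> and its alternating sum by
  \<open>(- 1) ^ (n div 2)\<close>; this is the difference.
\<close>

definition antipode_jump :: "nat \<Rightarrow> bool \<Rightarrow> int" where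
  "antipode_jump n b = (if b \<and> odd (n div 2) then 2 else 0)"

text \<open>Cardinality minus alternating sum counts each odd residue twice and no even one. An odd
  generator x yields two odd residues, x and n - x, which explains the 4.\<close>

lemma pm_residues_antipode:
  assumes n: "0 < n" "b \<longrightarrow> even n" and fin: "finite A"
    and A: "A \<subseteq> {1..}" "\<And>x. x \<in> A \<Longrightarrow> 2 * x < int n"
  shows "pm_residues_mod n A \<union> antipode n b \<subseteq> {1..<int n}"
    and "x \<in> pm_residues_mod n A \<union> antipode n b \<Longrightarrow> (- x) mod int n \<in> pm_residues_mod n A \<union> antipode n b"
    and "even n \<Longrightarrow> int (card (pm_residues_mod n A \<union> antipode n b)) -
           (\<Sum>x\<in>pm_residues_mod n A \<union> antipode n b. alternating x) =
           4 * int (card {x \<in> A. odd x}) + antipode_jump n b"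
proof -
  define Y where "Y = pm_residues_mod n A"
  have sym: "Y \<subseteq> {1..<int n}" "x \<in> Y \<Longrightarrow> (- x) mod int n \<in> Y" "even n \<Longrightarrow> int n div 2 \<notin> Y" for x
    unfolding Y_def by (rule pm_residues_symmetric[OF n(1) A]; assumption)+
  have antipode: "antipode n b \<subseteq> {1..<int n} \<and> (\<forall>x\<in>antipode n b. (- x) mod int n \<in> antipode n b)"
  proof (cases b)
    case True
    with n(2) obtain k where k: "n = 2 * k" by (auto elim: evenE)
    hence "int n div 2 = int k" "(- int k) mod int n = int k"
      using n(1) by (simp_all add: zmod_zminus1_eq_if)
    thus ?thesis
      using True k n(1) by (simp add: antipode_def)
  qed (simp add: antipode_def)
  show "pm_residues_mod n A \<union> antipode n b \<subseteq> {1..<int n}"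
    using sym(1) antipode unfolding Y_def by blast
  show "(- x) mod int n \<in> pm_residues_mod n A \<union> antipode n b" if "x \<in> pm_residues_mod n A \<union> antipode n b"
    using that sym(2) antipode unfolding Y_def by blast
  assume even: "even n"
  have parity: "alternating (int n div 2) = (if odd (n div 2) then - 1 else 1)"
    using even_of_nat[of "n div 2", where 'a = int] by (simp only: alternating_def of_nat_div of_nat_numeral) simp
  have "finite Y" by (rule finite_subset[OF sym(1)]) simp
  hence "int (card (Y \<union> antipode n b)) - (\<Sum>x\<in>Y \<union> antipode n b. alternating x) =
      int (card Y) - (\<Sum>x\<in>Y. alternating x) + antipode_jump n b"
    using sym(3)[OF even] parity by (cases b) (simp_all add: antipode_def antipode_jump_def)
  moreover have "card Y = 2 * card A" "(\<Sum>x\<in>Y. alternating x) = 2 * (\<Sum>x\<in>A. alternating x)"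
    unfolding Y_def using even by (auto intro: pm_residues_card[OF fin A])
  ultimately show "int (card (pm_residues_mod n A \<union> antipode n b)) -
      (\<Sum>x\<in>pm_residues_mod n A \<union> antipode n b. alternating x) =
      4 * int (card {x \<in> A. odd x}) + antipode_jump n b"
    using sum_alternating[OF fin] card_even_odd[OF fin] unfolding Y_def by linarith
qed

text \<open>The two parities exclude each other, so one sequence of witnesses serves as both
  \<open>a\<close> and \<open>b\<close>.\<close>

lemma choose_coefficients:
  fixes X :: "nat \<Rightarrow> int" and g :: "nat \<Rightarrow> nat"
  assumes "\<And>n. P n \<Longrightarrow> \<exists>c. X n = (if even (g n) then l else q) * c\<^sup>2"
  shows "\<exists>a b :: nat \<Rightarrow> int. \<forall>n. P n \<longrightarrow>
           (odd (g n) \<longrightarrow> X n = q * (a n)\<^sup>2) \<and> (even (g n) \<longrightarrow> X n = l * (b n)\<^sup>2)"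
proof -
  obtain c where "\<And>n. P n \<Longrightarrow> X n = (if even (g n) then l else q) * (c n)\<^sup>2"
    using assms by metis
  thus ?thesis by (intro exI[of _ c]) auto
qed

text \<open>The square factor of \<open>u\<close> is absorbed into the witness; this is how the
  square-free parts arise from the eigenvalues.\<close>

lemma squarefree_part_times_square:
  fixes u :: int
  shows "\<exists>d. u * c\<^sup>2 = squarefree_part u * d\<^sup>2"
  by (rule exI[of _ "square_part u * c"], subst (1) squarefree_decompose[of u]) (simp add: power_mult_distrib)

theorem theorem4p1:
  fixes r t s :: nat
    and \<alpha> \<beta> \<gamma> :: "nat \<Rightarrow> int"
    and k\<^sub>1 m\<^sub>1 h\<^sub>1 h\<^sub>2 :: int
    and l\<^sub>1 q\<^sub>1 q\<^sub>2 q\<^sub>3 q\<^sub>4 :: int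
    and R T S :: "nat \<Rightarrow> int set"
    and \<Gamma>\<^sub>1 \<Gamma>\<^sub>2 \<Gamma>\<^sub>3 \<Gamma>\<^sub>4 :: "nat \<Rightarrow> (int + int) ugraph"
    and admissible :: "nat \<Rightarrow> bool"
  assumes \<alpha>: "strict_mono_on {1..r} \<alpha>" "\<And>i. i \<in> {1..r} \<Longrightarrow> 1 \<le> \<alpha> i"
    and \<beta>: "strict_mono_on {1..t} \<beta>" "\<And>i. i \<in> {1..t} \<Longrightarrow> 1 \<le> \<beta> i"
    and \<gamma>: "strict_mono_on {1..s} \<gamma>" "\<And>i. i \<in> {1..s} \<Longrightarrow> 0 \<le> \<gamma> i"
    and k\<^sub>1: "k\<^sub>1 = int (card {x \<in> \<alpha> ` {1..r}. odd x})"
    and m\<^sub>1: "m\<^sub>1 = int (card {x \<in> \<beta> ` {1..t}. odd x})"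
    and h\<^sub>1: "h\<^sub>1 = int (card {x \<in> \<gamma> ` {1..s}. odd x})"
    and h\<^sub>2: "h\<^sub>2 = int (card {x \<in> \<gamma> ` {1..s}. even x})"
    and l\<^sub>1: "l\<^sub>1 = squarefree_part
      ((2 * int s + 1) * ((4 * k\<^sub>1 + int s + 1) * (4 * m\<^sub>1 + int s + 1) - (h\<^sub>2 - h\<^sub>1)\<^sup>2))"
    and q\<^sub>1: "q\<^sub>1 = squarefree_part (2 * int s + 1)"
    and q\<^sub>2: "q\<^sub>2 = squarefree_part
      ((2 * int s + 1) * ((4 * k\<^sub>1 + int s + 3) * (4 * m\<^sub>1 + int s + 1) - (h\<^sub>2 - h\<^sub>1)\<^sup>2))"
    and q\<^sub>3: "q\<^sub>3 = squarefree_part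
      ((2 * int s + 1) * ((4 * k\<^sub>1 + int s + 1) * (4 * m\<^sub>1 + int s + 3) - (h\<^sub>2 - h\<^sub>1)\<^sup>2))"
    and q\<^sub>4: "q\<^sub>4 = squarefree_part
      ((2 * int s + 1) * ((4 * k\<^sub>1 + int s + 3) * (4 * m\<^sub>1 + int s + 3) - (h\<^sub>2 - h\<^sub>1)\<^sup>2))"
    and admissible: "\<And>n. admissible n \<longleftrightarrow>
      0 < n \<and> (0 < r \<longrightarrow> 2 * \<alpha> r < int n) \<and> (0 < t \<longrightarrow> 2 * \<beta> t < int n)
      \<and> (0 < s \<longrightarrow> \<gamma> s \<le> int n - 1)"
    and R: "\<And>n. R n = pm_residues_mod n (\<alpha> ` {1..r})"
    and T: "\<And>n. T n = pm_residues_mod n (\<beta> ` {1..t})"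
    and S: "\<And>n. S n = residues_mod n (\<gamma> ` {1..s})"
    and \<Gamma>\<^sub>1: "\<And>n. \<Gamma>\<^sub>1 n = bicirculant n (R n) (T n) (S n)"
    and \<Gamma>\<^sub>2: "\<And>n. \<Gamma>\<^sub>2 n = bicirculant n (R n \<union> {int n div 2}) (T n) (S n)"
    and \<Gamma>\<^sub>3: "\<And>n. \<Gamma>\<^sub>3 n = bicirculant n (R n) (T n \<union> {int n div 2}) (S n)"
    and \<Gamma>\<^sub>4: "\<And>n. \<Gamma>\<^sub>4 n = bicirculant n (R n \<union> {int n div 2}) (T n \<union> {int n div 2}) (S n)"
  shows
    "(\<exists>a\<^sub>1 b\<^sub>1 :: nat \<Rightarrow> int. \<forall>n. admissible n \<and> connected_ugraph (\<Gamma>\<^sub>1 n) \<longrightarrow>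
        (odd n \<longrightarrow> int (num_rooted_spanning_forests (\<Gamma>\<^sub>1 n)) = q\<^sub>1 * (a\<^sub>1 n)\<^sup>2) \<and>
        (even n \<longrightarrow> int (num_rooted_spanning_forests (\<Gamma>\<^sub>1 n)) = l\<^sub>1 * (b\<^sub>1 n)\<^sup>2)) \<and>
     (\<exists>a\<^sub>2 b\<^sub>2 :: nat \<Rightarrow> int. \<forall>n. admissible n \<and> even n \<and> connected_ugraph (\<Gamma>\<^sub>2 n) \<longrightarrow>
        (odd (n div 2) \<longrightarrow> int (num_rooted_spanning_forests (\<Gamma>\<^sub>2 n)) = q\<^sub>2 * (a\<^sub>2 n)\<^sup>2) \<and>
        (even (n div 2) \<longrightarrow> int (num_rooted_spanning_forests (\<Gamma>\<^sub>2 n)) = l\<^sub>1 * (b\<^sub>2 n)\<^sup>2)) \<and>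
     (\<exists>a\<^sub>3 b\<^sub>3 :: nat \<Rightarrow> int. \<forall>n. admissible n \<and> even n \<and> connected_ugraph (\<Gamma>\<^sub>3 n) \<longrightarrow>
        (odd (n div 2) \<longrightarrow> int (num_rooted_spanning_forests (\<Gamma>\<^sub>3 n)) = q\<^sub>3 * (a\<^sub>3 n)\<^sup>2) \<and>
        (even (n div 2) \<longrightarrow> int (num_rooted_spanning_forests (\<Gamma>\<^sub>3 n)) = l\<^sub>1 * (b\<^sub>3 n)\<^sup>2)) \<and>
     (\<exists>a\<^sub>4 b\<^sub>4 :: nat \<Rightarrow> int. \<forall>n. admissible n \<and> even n \<and> connected_ugraph (\<Gamma>\<^sub>4 n) \<longrightarrow>
        (odd (n div 2) \<longrightarrow> int (num_rooted_spanning_forests (\<Gamma>\<^sub>4 n)) = q\<^sub>4 * (a\<^sub>4 n)\<^sup>2) \<and>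
        (even (n div 2) \<longrightarrow> int (num_rooted_spanning_forests (\<Gamma>\<^sub>4 n)) = l\<^sub>1 * (b\<^sub>4 n)\<^sup>2))"
proof -
  define A where "A = \<alpha> ` {1..r}"
  define B where "B = \<beta> ` {1..t}"
  define C where "C = \<gamma> ` {1..s}"
  have fin: "finite A" "finite B" "finite C" by (simp_all add: A_def B_def C_def)
  have cards: "card A = r" "card B = t" "card C = s"
    using \<alpha>(1) \<beta>(1) \<gamma>(1) by (simp_all add: A_def B_def C_def card_image strict_mono_on_imp_inj_on)
  have pos: "A \<subseteq> {1..}" "B \<subseteq> {1..}" "C \<subseteq> {0..}"
    using \<alpha>(2) \<beta>(2) \<gamma>(2) by (auto simp: A_def B_def C_def)
  \<comment> \<open>The bounds concern the last index and reach all others by monotonicity;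
    \<open>0 < u\<close> unlocks the conditions that are vacuous for an empty list.\<close>
  have le_last: "x \<le> f u" "0 < u" if "strict_mono_on {1..u} f" "x \<in> f ` {1..u}" for x :: int and f and u :: nat
  proof -
    obtain i where "x = f i" "1 \<le> i" "i \<le> u" using \<open>x \<in> f ` {1..u}\<close> by auto
    thus "x \<le> f u" "0 < u" using strict_mono_on_leD[OF that(1), of i u] by auto
  qed
  have adm: "0 < n" "\<forall>x\<in>A. 2 * x < int n" "\<forall>x\<in>B. 2 * x < int n" "\<forall>x\<in>C. x < int n"
    if "admissible n" for n
  proof -
    have bounds: "0 < r \<longrightarrow> 2 * \<alpha> r < int n" "0 < t \<longrightarrow> 2 * \<beta> t < int n" "0 < s \<longrightarrow> \<gamma> s \<le> int n - 1"
      using that by (simp_all add: admissible)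
    show "0 < n" using that by (simp add: admissible)
    show "\<forall>x\<in>A. 2 * x < int n"
      unfolding A_def using le_last[OF \<alpha>(1)] bounds(1) by fastforce
    show "\<forall>x\<in>B. 2 * x < int n"
      unfolding B_def using le_last[OF \<beta>(1)] bounds(2) by fastforce
    show "\<forall>x\<in>C. x < int n"
      unfolding C_def using le_last[OF \<gamma>(1)] bounds(3) by fastforce
  qed
  have alt: "(\<Sum>x\<in>C. alternating x) = h\<^sub>2 - h\<^sub>1"
    using sum_alternating[OF fin(3)] by (simp add: h\<^sub>1 h\<^sub>2 C_def)
  \<comment> \<open>The elements of \<open>C\<close> are their own residues, so the parities counted
    by \<open>h\<^sub>1\<close> and \<open>h\<^sub>2\<close> survive reduction modulo
    \<open>n\<close>.\<close>
  have S_eq: "S n = C" if "admissible n" for n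
  proof -
    have "x mod int n = x" if "x \<in> C" for x
      using that adm(4)[OF \<open>admissible n\<close>] pos(3) by auto
    hence "(\<lambda>x. x mod int n) ` C = (\<lambda>x. x) ` C" by (intro image_cong refl)
    thus ?thesis unfolding S residues_mod_def C_def[symmetric] by simp
  qed
  \<comment> \<open>\<open>b\<close> and \<open>b'\<close> tell whether n/2 joins \<open>R n\<close>
    and \<open>T n\<close>. For odd \<open>n\<close> the alternating eigenvalue is absent and 1
    takes its place.\<close>
  have count: "\<exists>c. int (num_rooted_spanning_forests (bicirculant n (R n \<union> antipode n b) (T n \<union> antipode n b') (S n))) =
      squarefree_part ((2 * int s + 1) * (if even n then
        (4 * k\<^sub>1 + int s + 1 + antipode_jump n b) * (4 * m\<^sub>1 + int s + 1 + antipode_jump n b') - (h\<^sub>2 - h\<^sub>1)\<^sup>2 else 1)) * c\<^sup>2"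
    if ad: "admissible n" "b \<or> b' \<longrightarrow> even n" for n b b'
  proof -
    have even: "b \<longrightarrow> even n" "b' \<longrightarrow> even n" using ad(2) by auto
    have RA: "R n = pm_residues_mod n A" and TB: "T n = pm_residues_mod n B"
      by (simp_all add: R T A_def B_def)
    have A: "\<And>x. x \<in> A \<Longrightarrow> 2 * x < int n" and B: "\<And>x. x \<in> B \<Longrightarrow> 2 * x < int n"
      using adm[OF ad(1)] by auto
    have extR: "R n \<union> antipode n b \<subseteq> {1..<int n}"
        "\<And>x. x \<in> R n \<union> antipode n b \<Longrightarrow> (- x) mod int n \<in> R n \<union> antipode n b"
        "even n \<Longrightarrow> int (card (R n \<union> antipode n b)) - (\<Sum>x\<in>R n \<union> antipode n b. alternating x) =
           4 * k\<^sub>1 + antipode_jump n b"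
      unfolding RA k\<^sub>1 A_def[symmetric]
      by (rule pm_residues_antipode[OF adm(1)[OF ad(1)] even(1) fin(1) pos(1) A]; assumption)+
    have extT: "T n \<union> antipode n b' \<subseteq> {1..<int n}"
        "\<And>x. x \<in> T n \<union> antipode n b' \<Longrightarrow> (- x) mod int n \<in> T n \<union> antipode n b'"
        "even n \<Longrightarrow> int (card (T n \<union> antipode n b')) - (\<Sum>x\<in>T n \<union> antipode n b'. alternating x) =
           4 * m\<^sub>1 + antipode_jump n b'"
      unfolding TB m\<^sub>1 B_def[symmetric]
      by (rule pm_residues_antipode[OF adm(1)[OF ad(1)] even(2) fin(2) pos(2) B]; assumption)+
    interpret bicirculant_data n "R n \<union> antipode n b" "T n \<union> antipode n b'" "S n"
    proof
      show "S n \<subseteq> {0..<int n}" using S_eq[OF ad(1)] adm(4)[OF ad(1)] pos(3) by auto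
    qed (fact adm(1)[OF ad(1)] extR(1) extT(1) | erule extR(2) extT(2))+
    obtain c where c: "int (num_rooted_spanning_forests G) = (2 * int (card (S n)) + 1) *
       (if even n then
          (1 + int (card (R n \<union> antipode n b)) + int (card (S n)) - (\<Sum>x\<in>R n \<union> antipode n b. alternating x)) *
          (1 + int (card (T n \<union> antipode n b')) + int (card (S n)) - (\<Sum>x\<in>T n \<union> antipode n b'. alternating x))
          - (\<Sum>x\<in>S n. alternating x)\<^sup>2
        else 1) * c\<^sup>2"
      using num_forests by blast
    have "int (num_rooted_spanning_forests G) = ((2 * int s + 1) * (if even n then
        (4 * k\<^sub>1 + int s + 1 + antipode_jump n b) * (4 * m\<^sub>1 + int s + 1 + antipode_jump n b') - (h\<^sub>2 - h\<^sub>1)\<^sup>2 else 1)) * c\<^sup>2"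
    proof (cases "even n")
      case True
      have "1 + int (card (R n \<union> antipode n b)) + int s - (\<Sum>x\<in>R n \<union> antipode n b. alternating x) =
          4 * k\<^sub>1 + int s + 1 + antipode_jump n b"
        "1 + int (card (T n \<union> antipode n b')) + int s - (\<Sum>x\<in>T n \<union> antipode n b'. alternating x) =
          4 * m\<^sub>1 + int s + 1 + antipode_jump n b'"
        using extR(3)[OF True] extT(3)[OF True] by linarith+
      with c show ?thesis unfolding S_eq[OF ad(1)] cards alt by (simp only: True if_True)
    qed (use c in \<open>simp add: S_eq[OF ad(1)] cards\<close>)
    thus ?thesis
      by (simp only: squarefree_part_times_square)
  qed
  have "\<exists>c. int (num_rooted_spanning_forests (\<Gamma>\<^sub>1 n)) = (if even n then l\<^sub>1 else q\<^sub>1) * c\<^sup>2"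
    if "admissible n \<and> connected_ugraph (\<Gamma>\<^sub>1 n)" for n
    using count[of n False False] that by (auto simp: antipode_def antipode_jump_def q\<^sub>1 l\<^sub>1 \<Gamma>\<^sub>1)
  \<comment> \<open>For odd n/2 an added antipode raises its factor from s + 1 to s + 3; for even
    n/2 the jump is 0, which brings back \<open>l\<^sub>1\<close>.\<close>
  moreover have "\<exists>c. int (num_rooted_spanning_forests (\<Gamma>\<^sub>2 n)) = (if even (n div 2) then l\<^sub>1 else q\<^sub>2) * c\<^sup>2"
    if "admissible n \<and> even n \<and> connected_ugraph (\<Gamma>\<^sub>2 n)" for n
    using count[of n True False] that by (auto simp: antipode_def antipode_jump_def q\<^sub>2 l\<^sub>1 \<Gamma>\<^sub>2 add.commute)
  moreover have "\<exists>c. int (num_rooted_spanning_forests (\<Gamma>\<^sub>3 n)) = (if even (n div 2) then l\<^sub>1 else q\<^sub>3) * c\<^sup>2"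
    if "admissible n \<and> even n \<and> connected_ugraph (\<Gamma>\<^sub>3 n)" for n
    using count[of n False True] that by (auto simp: antipode_def antipode_jump_def q\<^sub>3 l\<^sub>1 \<Gamma>\<^sub>3 add.commute)
  moreover have "\<exists>c. int (num_rooted_spanning_forests (\<Gamma>\<^sub>4 n)) = (if even (n div 2) then l\<^sub>1 else q\<^sub>4) * c\<^sup>2"
    if "admissible n \<and> even n \<and> connected_ugraph (\<Gamma>\<^sub>4 n)" for n
    using count[of n True True] that by (auto simp: antipode_def antipode_jump_def q\<^sub>4 l\<^sub>1 \<Gamma>\<^sub>4 add.commute)
  ultimately show ?thesis
    by (intro conjI choose_coefficients[where g = "\<lambda>n. n"] choose_coefficients[where g = "\<lambda>n. n div 2"]) blast+
qed

end
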